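(* Let $G$ be a unicyclic graph. (a) If the unique cycle of $G$ is an odd cycle, then $\mathrm{cdim}(G)=\dim(G)$ if and only if $G \in \mathcal{U}_1$. (b) If the unique cycle of $G$ is an even cycle, then $\mathrm{cdim}(G)=\dim(G)$ if and only if $G \in \mathcal{U}_2$.
   Context: Graphs are finite, simple, undirected and connected; a unicyclic graph is a connected graph with exactly one cycle. A set $S\subseteq V(G)$ is a resolving set of $G$ if for every pair of distinct vertices $x,y$ of $G$ there is $z\in S$ with $d(x,z)\ne d(y,z)$ ($d$ is the shortest-path distance); it is a connected resolving set if moreover the induced subgraph $G[S]$ is connected. $\dim(G)$ is the minimum cardinality of a resolving set of $G$, and $\mathrm{cdim}(G)$ is the minimum cardinality of a connected resolving set of $G$. For $m\ge 3$, a generalized $m$-sun is a unicyclic graph obtained from the cycle $C_m$ by adding at most one path to each vertex of $C_m$ (i.e. at each cycle vertex, at most one pendant path is attached, by joining an end vertex of that path to the cycle vertex, so that each cycle vertex has degree two or three). $\mathcal{U}_1$ is the collection of all generalized $(2k+1)$-suns, $k\ge 1$, such that at least $2k-2$ consecutive vertices on the unique cycle are of degree two (in the whole graph). $\mathcal{U}_2$ is the collection of all generalized $2k$-suns, $k\ge 2$, such that at least $2k-2$ consecutive vertices on the unique cycle are of degree two (in the whole graph). *)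

theory Defs
  imports "Graph_Theory.Graph_Theory" "HOL-Library.Disjoint_Sets"
begin

text \<open>
  A finite simple undirected graph is a \<open>pair_graph\<close>: an edge \<open>{u, v}\<close> is represented by the two
  arcs \<open>(u, v)\<close> and \<open>(v, u)\<close>.
\<close>

definition gdist :: "'a pair_pre_digraph \<Rightarrow> 'a \<Rightarrow> 'a \<Rightarrow> ereal" where
  "gdist G = wf_digraph.\<mu> (with_proj G) (\<lambda>_. 1)"

definition resolving_set :: "'a pair_pre_digraph \<Rightarrow> 'a set \<Rightarrow> bool" where
  "resolving_set G S \<longleftrightarrow> S \<subseteq> pverts G \<and>
     (\<forall>x\<in>pverts G. \<forall>y\<in>pverts G. x \<noteq> y \<longrightarrow> (\<exists>z\<in>S. gdist G x z \<noteq> gdist G y z))"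

definition connected_resolving_set :: "'a pair_pre_digraph \<Rightarrow> 'a set \<Rightarrow> bool" where
  "connected_resolving_set G S \<longleftrightarrow>
     resolving_set G S \<and> Digraph_Component.connected (with_proj G \<restriction> S)"

definition metric_dim :: "'a pair_pre_digraph \<Rightarrow> nat" where
  "metric_dim G = (LEAST n. \<exists>S. resolving_set G S \<and> card S = n)"

definition connected_metric_dim :: "'a pair_pre_digraph \<Rightarrow> nat" where
  "connected_metric_dim G = (LEAST n. \<exists>S. connected_resolving_set G S \<and> card S = n)"

definition cycle_graph :: "'a list \<Rightarrow> 'a pair_pre_digraph" where
  "cycle_graph cs = mk_symmetric (with_proj
     \<lparr> pverts = set cs, parcs = set (vwalk_arcs (cs @ [hd cs])) \<rparr>)"

text \<open>
  Cycles are taken as subgraphs, so that the choice of a starting vertex and of an orientation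
  does not count. The library's \<open>cycle\<close> is not used because it is a directed closed walk, and it
  also admits \<open>u, v, u\<close>.
\<close>

definition cycles_of :: "'a pair_pre_digraph \<Rightarrow> 'a pair_pre_digraph set" where
  "cycles_of G = {C. subgraph (with_proj C) (with_proj G) \<and>
     (\<exists>cs. distinct cs \<and> 3 \<le> length cs \<and> C = cycle_graph cs)}"

definition unicyclic :: "'a pair_pre_digraph \<Rightarrow> bool" where
  "unicyclic G \<longleftrightarrow> pair_graph G \<and> Digraph_Component.connected (with_proj G) \<and>
     (\<exists>!C. C \<in> cycles_of G)"

text \<open>
  The cycle with vertices \<open>cs\<close> in cyclic order, where the path with vertices \<open>P i\<close> is joined
  by its first vertex to the cycle vertex \<open>cs ! i\<close>. The empty list means that no path is
  attached to \<open>cs ! i\<close>.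
\<close>

definition sun_graph :: "'a list \<Rightarrow> (nat \<Rightarrow> 'a list) \<Rightarrow> 'a pair_pre_digraph" where
  "sun_graph cs P = mk_symmetric (with_proj
     \<lparr> pverts = set cs \<union> (\<Union>i<length cs. set (P i)),
       parcs = set (vwalk_arcs (cs @ [hd cs])) \<union>
               (\<Union>i<length cs. set (vwalk_arcs (cs ! i # P i))) \<rparr>)"

definition generalized_sun :: "nat \<Rightarrow> 'a list \<Rightarrow> 'a pair_pre_digraph \<Rightarrow> bool" where
  "generalized_sun m cs G \<longleftrightarrow> 3 \<le> m \<and> length cs = m \<and> distinct cs \<and>
     (\<exists>P. (\<forall>i<m. distinct (P i) \<and> set (P i) \<inter> set cs = {}) \<and>
          disjoint_family_on (\<lambda>i. set (P i)) {..<m} \<and>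
          G = sun_graph cs P)"

text \<open>
  In a \<open>pair_graph\<close> the out-degree of a vertex is its number of neighbours, i.e. its degree.
\<close>

definition consecutive_degree_two :: "nat \<Rightarrow> 'a list \<Rightarrow> 'a pair_pre_digraph \<Rightarrow> bool" where
  "consecutive_degree_two n cs G \<longleftrightarrow>
     (\<exists>j. \<forall>i<n. out_degree (with_proj G) (cs ! ((j + i) mod length cs)) = 2)"

definition U1 :: "'a pair_pre_digraph set" where
  "U1 = {G. \<exists>k\<ge>1. \<exists>cs. generalized_sun (2 * k + 1) cs G \<and>
                          consecutive_degree_two (2 * k - 2) cs G}"

definition U2 :: "'a pair_pre_digraph set" where
  "U2 = {G. \<exists>k\<ge>2. \<exists>cs. generalized_sun (2 * k) cs G \<and>
                          consecutive_degree_two (2 * k - 2) cs G}"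

end

theory Submission
  imports Defs
begin

text \<open>
  A connected resolving set with two elements is the pair of ends of an edge. If that edge lies
  outside the unique cycle it is a bridge: all cycle vertices then lie on one side of it, and its
  ends resolve no more of them than one end alone, which is too little. An edge \<open>c\<^sub>0 c\<^sub>1\<close> of the
  cycle resolves the graph exactly if the graph is a sun whose paths hang only at the vertices
  opposite to the edge (on a triangle: at any vertices). Along either half of the
  cycle both distances grow by one per step, so a path at an inner vertex of a half would repeat the
  distances of the next cycle vertex. Two opposite vertices remain on an even cycle and three on an
  odd one; this is membership in \<open>U1\<close> or \<open>U2\<close>. As no single vertex resolves a graph with a cycle, both dimensions are then \<open>2\<close>
  (\<open>equal_dims_of_sun\<close>).

  It remains to see that a connected resolving set \<open>S\<close> with at least three elements is never a
  minimum resolving set (\<open>sun_of_equal_dims\<close>). Let \<open>v\<close>, \<open>x\<close>, \<open>y\<close> be in \<open>S\<close>, with \<open>x\<close> and \<open>y\<close>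
  neighbours of \<open>v\<close>, and let the edge \<open>v x\<close> be a bridge. Then the distance to \<open>v\<close> is one less than the
  larger of the distances to \<open>x\<close> and \<open>y\<close> (\<open>bridge_max\<close>), so \<open>v\<close> can be left out of \<open>S\<close>. In a
  unicyclic graph every edge outside the cycle is a bridge (\<open>unique_cycle_bridge\<close>); hence if \<open>S\<close> is
  minimal, it lies on the cycle and contains three consecutive cycle vertices
  (\<open>minimal_on_cycle\<close>, \<open>minimal_consecutive\<close>). Cycle vertices cannot distinguish two vertices at
  the same height over the same cycle vertex, so every branch is a path and the graph is a sun
  (\<open>resolved_from_cycle_is_sun\<close>).

  For a sun, distances are explicit (\<open>d_pt\<close>) and small resolving sets can be written down. Every sun
  is resolved by three suitable cycle vertices (\<open>triple_resolves\<close>), which excludes \<open>card S \<ge> 4\<close>. If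
  three consecutive vertices of a cycle of length \<open>n \<ge> 4\<close> resolve the sun, then all paths hang at the
  middle one of them or around the vertices farthest from it. In this case the ends of the paths at the
  middle vertex and at distance \<open>(n - 1) div 2\<close> from it resolve the sun (\<open>path3_not_optimal\<close>), where
  the end of an empty path is the cycle vertex itself. This excludes \<open>card S = 3\<close> for \<open>n \<ge> 4\<close>; on a
  triangle any two cycle vertices resolve the sun.
\<close>

section \<open>Distances in a symmetric relation\<close>

text \<open>
  The distance as a natural number, for a bare relation: it agrees with \<open>gdist\<close> on connected graphs
  (\<open>gdist_eq\<close>) and allows induction and linear arithmetic.
\<close>

definition ndist :: "'a rel \<Rightarrow> 'a \<Rightarrow> 'a \<Rightarrow> nat" where
  "ndist E u v = (LEAST n. (u, v) \<in> E ^^ n)"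

locale ugraph =
  fixes V :: "'a set" and E :: "'a rel"
  assumes fin: "finite V"
    and arcs_in: "E \<subseteq> V \<times> V"
    and sym_arcs: "sym E"
    and loopless: "(v, v) \<notin> E"
    and connected: "u \<in> V \<Longrightarrow> v \<in> V \<Longrightarrow> (u, v) \<in> E\<^sup>*"
begin

abbreviation "d \<equiv> ndist E"

lemma sym: "(u, v) \<in> E \<Longrightarrow> (v, u) \<in> E"
  using sym_arcs by (auto elim: symE)

lemma walk_d: "u \<in> V \<Longrightarrow> v \<in> V \<Longrightarrow> (u, v) \<in> E ^^ d u v"
  unfolding ndist_def by (rule LeastI_ex) (metis connected rtrancl_imp_relpow)

lemma d_le: "(u, v) \<in> E ^^ n \<Longrightarrow> d u v \<le> n"
  unfolding ndist_def by (rule Least_le)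

lemma d_self [simp]: "d u u = 0"
  using d_le[of u u 0] by simp

lemma d_eq_0: "u \<in> V \<Longrightarrow> v \<in> V \<Longrightarrow> d u v = 0 \<longleftrightarrow> u = v"
  using walk_d[of u v] by auto

lemma d_sym: "d u v = d v u"
proof -
  have "(v, u) \<in> E ^^ n" if "(u, v) \<in> E ^^ n" for n u v
    using that
  proof (induction n arbitrary: v)
    case (Suc n)
    then show ?case
      by (metis relpow_Suc_E relpow_Suc_I2 sym)
  qed auto
  then have "(u, v) \<in> E ^^ n \<longleftrightarrow> (v, u) \<in> E ^^ n" for n
    by blast
  then show ?thesis
    unfolding ndist_def by simp
qed

lemma d_step:
  assumes "z \<in> V" and "(v, w) \<in> E"
  shows "d z w \<le> d z v + 1"
proof -
  have "(z, w) \<in> E ^^ Suc (d z v)"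
    using walk_d[of z v] assms arcs_in by auto
  then show ?thesis
    using d_le by fastforce
qed

lemma d_pred:
  assumes "z \<in> V" "v \<in> V" "v \<noteq> z"
  obtains u where "(u, v) \<in> E" "d z v = d z u + 1"
proof -
  obtain n where n: "d z v = Suc n"
    using assms d_eq_0[of z v] not0_implies_Suc by metis
  then obtain u where u: "(z, u) \<in> E ^^ n" "(u, v) \<in> E"
    using walk_d[of z v] assms by auto
  then have "d z v = d z u + 1"
    using d_le[OF u(1)] d_step[of z u v] assms n by linarith
  then show ?thesis
    using that u by blast
qed

lemma d_adj:
  assumes "(u, v) \<in> E"
  shows "d u v = 1"
proof -
  have "u \<in> V" "v \<in> V" "u \<noteq> v"
    using assms arcs_in loopless by auto
  then show ?thesis
    using d_step[of u u v] d_eq_0[of u v] assms by simp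
qed

text \<open>
  This reduces the computation of a distance function to a check on single edges: a function that
  changes by at most one along an edge cannot exceed the distance from its zero \<open>z\<close>, and a
  neighbour of smaller value at every other vertex yields a path to \<open>z\<close> of the required length.
\<close>

lemma d_eq_potential:
  assumes z: "z \<in> V" and "f z = 0"
    and lip: "\<And>u v. (u, v) \<in> E \<Longrightarrow> f v \<le> f u + 1"
    and down: "\<And>v. v \<in> V \<Longrightarrow> v \<noteq> z \<Longrightarrow> \<exists>u. (u, v) \<in> E \<and> f u < f v"
    and v: "v \<in> V"
  shows "d z v = f v"
proof (rule antisym)
  show "d z v \<le> f v"
    using v
  proof (induction "f v" arbitrary: v rule: less_induct)
    case less
    show ?case
    proof (cases "v = z")
      case False
      then obtain u where u: "(u, v) \<in> E" "f u < f v"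
        using down less.prems by blast
      then have "d z u \<le> f u"
        using less.hyps arcs_in by blast
      then show ?thesis
        using u d_step[OF z u(1)] by linarith
    qed simp
  qed
  have "f v \<le> n" if "(z, v) \<in> E ^^ n" for n
    using that
  proof (induction n arbitrary: v)
    case (Suc n)
    then obtain u where "(z, u) \<in> E ^^ n" "(u, v) \<in> E"
      by auto
    then show ?case
      using Suc.IH lip by fastforce
  qed (use \<open>f z = 0\<close> in auto)
  then show "f v \<le> d z v"
    using walk_d z v by blast
qed

definition resolves :: "'a set \<Rightarrow> bool" where
  "resolves S \<longleftrightarrow> S \<subseteq> V \<and> (\<forall>x\<in>V. \<forall>y\<in>V. (\<forall>z\<in>S. d x z = d y z) \<longrightarrow> x = y)"

definition conn_on :: "'a set \<Rightarrow> bool" where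
  "conn_on S \<longleftrightarrow> S \<noteq> {} \<and> (\<forall>u\<in>S. \<forall>v\<in>S. (u, v) \<in> (E \<inter> S \<times> S)\<^sup>*)"

lemma resolves_V: "resolves V"
  unfolding resolves_def by (metis d_eq_0 d_self order_refl)

end

lemma rtrancl_on_eq:
  assumes "r \<subseteq> F \<times> F" "u \<in> F"
  shows "(u, v) \<in> rtrancl_on F r \<longleftrightarrow> (u, v) \<in> r\<^sup>*"
proof
  show "(u, v) \<in> r\<^sup>*" if "(u, v) \<in> rtrancl_on F r"
    using that by (induction) (auto intro: rtrancl_into_rtrancl)
  show "(u, v) \<in> rtrancl_on F r" if "(u, v) \<in> r\<^sup>*"
    using that by (induction) (use assms in \<open>auto intro: rtrancl_on_into_rtrancl_on\<close>)
qed

lemma connected_induced_iff: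
  assumes "sym (parcs G)" and "S \<subseteq> pverts G"
  shows "Digraph_Component.connected (with_proj G \<restriction> S) \<longleftrightarrow>
    S \<noteq> {} \<and> (\<forall>u\<in>S. \<forall>v\<in>S. (u, v) \<in> (parcs G \<inter> S \<times> S)\<^sup>*)"
proof -
  have "parcs (mk_symmetric (with_proj G \<restriction> S)) = parcs G \<inter> S \<times> S"
    using assms(1) by (auto simp: parcs_mk_symmetric elim: symE)
  then show ?thesis
    unfolding Digraph_Component.connected_def strongly_connected_def reachable_def
    by (auto simp: rtrancl_on_eq)
qed

lemma connected_iff:
  assumes "pair_graph G"
  shows "Digraph_Component.connected (with_proj G) \<longleftrightarrow>
    pverts G \<noteq> {} \<and> (\<forall>u\<in>pverts G. \<forall>v\<in>pverts G. (u, v) \<in> (parcs G)\<^sup>*)"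
proof -
  interpret pair_graph G by fact
  have "parcs (mk_symmetric (with_proj G)) = parcs G"
    by (auto simp: parcs_mk_symmetric intro: arcs_symmetric)
  moreover have "parcs G \<subseteq> pverts G \<times> pverts G"
    using wellformed' by auto
  ultimately show ?thesis
    unfolding Digraph_Component.connected_def strongly_connected_def reachable_def
    by (auto simp: rtrancl_on_eq)
qed

locale conn_graph =
  fixes G :: "'a pair_pre_digraph"
  assumes pair_graph: "pair_graph G" and conn: "Digraph_Component.connected (with_proj G)"

sublocale conn_graph \<subseteq> ugraph "pverts G" "parcs G"
proof -
  interpret pair_graph G by (rule pair_graph)
  show "ugraph (pverts G) (parcs G)"
  proof
    show "finite (pverts G)"
      by (rule pair_finite_verts)
    show "parcs G \<subseteq> pverts G \<times> pverts G"
      using wellformed' by auto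
    show "sym (parcs G)"
      by (auto intro!: symI arcs_symmetric)
    show "(v, v) \<notin> parcs G" for v
      using no_loops' by blast
    show "u \<in> pverts G \<Longrightarrow> v \<in> pverts G \<Longrightarrow> (u, v) \<in> (parcs G)\<^sup>*" for u v
      using conn connected_iff[OF pair_graph] by blast
  qed
qed

context conn_graph
begin

text \<open>
  All edges have cost one, so the infimum of the costs of the walks is attained by a shortest walk.
\<close>

lemma gdist_eq:
  assumes u: "u \<in> pverts G" and v: "v \<in> pverts G"
  shows "gdist G u v = ereal (real (d u v))"
proof -
  interpret pair_graph G by (rule pair_graph)
  have cost: "awalk_cost (\<lambda>_. 1) p = real (length p)" for p :: "('a \<times> 'a) list"
    by (induction p) auto
  have walk: "(\<exists>p. awalk w p v \<and> length p = n) \<longleftrightarrow> (w, v) \<in> parcs G ^^ n" if "w \<in> pverts G" for n w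
    using that
  proof (induction n arbitrary: w)
    case 0
    then show ?case
      using v by (auto simp: awalk_Nil_iff)
  next
    case (Suc n)
    have "(\<exists>p. awalk w p v \<and> length p = Suc n) \<longleftrightarrow>
        (\<exists>e q. awalk w (e # q) v \<and> length q = n)"
      by (metis length_Suc_conv)
    also have "\<dots> \<longleftrightarrow> (\<exists>x. (w, x) \<in> parcs G \<and> (\<exists>p. awalk x p v \<and> length p = n))"
      by (auto simp: awalk_Cons_iff)
    also have "\<dots> \<longleftrightarrow> (\<exists>x. (w, x) \<in> parcs G \<and> (x, v) \<in> parcs G ^^ n)"
      using Suc.IH wellformed' by blast
    also have "\<dots> \<longleftrightarrow> (w, v) \<in> parcs G ^^ Suc n"
      by (metis relpow_Suc_D2 relpow_Suc_I2)
    finally show ?case .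
  qed
  obtain p where p: "awalk u p v" "length p = d u v"
    using walk[OF u] walk_d[OF u v] by blast
  have le: "d u v \<le> length p'" if "awalk u p' v" for p'
    using that walk[OF u] d_le by blast
  show ?thesis
    unfolding gdist_def \<mu>_def cost
  proof (rule antisym)
    show "(INF p\<in>{p. awalk u p v}. ereal (real (length p))) \<le> ereal (real (d u v))"
      using p by (metis (mono_tags, lifting) INF_lower mem_Collect_eq)
    show "ereal (real (d u v)) \<le> (INF p\<in>{p. awalk u p v}. ereal (real (length p)))"
      using le by (auto intro!: INF_greatest)
  qed
qed

lemma resolving_set_iff: "resolving_set G S \<longleftrightarrow> resolves S"
proof (cases "S \<subseteq> pverts G")
  case True
  then have "gdist G x z = gdist G y z \<longleftrightarrow> d x z = d y z"
    if "x \<in> pverts G" "y \<in> pverts G" "z \<in> S" for x y z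
    using that gdist_eq[of _ z] by (simp add: subset_iff)
  then show ?thesis
    unfolding resolving_set_def resolves_def by blast
qed (simp add: resolving_set_def resolves_def)

lemma connected_resolving_set_iff: "connected_resolving_set G S \<longleftrightarrow> resolves S \<and> conn_on S"
  unfolding connected_resolving_set_def resolving_set_iff conn_on_def
  using connected_induced_iff[OF sym_arcs] resolves_def by metis

lemma metric_dim_le: "resolves S \<Longrightarrow> metric_dim G \<le> card S"
  unfolding metric_dim_def resolving_set_iff by (rule Least_le) blast

lemma metric_dim_attained:
  obtains S where "resolves S" "card S = metric_dim G"
  using LeastI_ex[of "\<lambda>n. \<exists>S. resolves S \<and> card S = n"] resolves_V
  unfolding metric_dim_def resolving_set_iff by blast

lemma connected_metric_dim_le: "resolves S \<Longrightarrow> conn_on S \<Longrightarrow> connected_metric_dim G \<le> card S"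
  unfolding connected_metric_dim_def connected_resolving_set_iff by (rule Least_le) blast

lemma conn_on_V: "conn_on (pverts G)"
  using conn connected_iff[OF pair_graph] arcs_in unfolding conn_on_def
  by (simp add: Int_absorb2)

lemma connected_metric_dim_attained:
  obtains S where "resolves S" "conn_on S" "card S = connected_metric_dim G"
  using LeastI_ex[of "\<lambda>n. \<exists>S. (resolves S \<and> conn_on S) \<and> card S = n"] resolves_V conn_on_V
  unfolding connected_metric_dim_def connected_resolving_set_iff by blast

lemma metric_dim_le_connected: "metric_dim G \<le> connected_metric_dim G"
  by (metis connected_metric_dim_attained metric_dim_le)

end

section \<open>Bridges\<close>

context ugraph
begin

definition bridge :: "'a \<Rightarrow> 'a \<Rightarrow> bool" where
  "bridge u w \<longleftrightarrow> (u, w) \<in> E \<and> (u, w) \<notin> (E - {(u, w), (w, u)})\<^sup>*"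

lemma sym_minus_edge: "sym (E - {(u, w), (w, u)})"
  using sym by (auto intro!: symI)

lemma reach_minus_edge_sym:
  "(x, y) \<in> (E - {(u, w), (w, u)})\<^sup>* \<Longrightarrow> (y, x) \<in> (E - {(u, w), (w, u)})\<^sup>*"
  by (meson sym_minus_edge sym_rtrancl symE)

lemma bridge_sym: "bridge u w \<Longrightarrow> bridge w u"
  unfolding bridge_def
  using sym reach_minus_edge_sym[of w u u w] by (simp add: insert_commute) blast

text \<open>
  A shortest path from \<open>z\<close> to \<open>x\<close> has its earlier vertices closer to \<open>z\<close> than \<open>x\<close>, so it does not
  meet \<open>w\<close> and cannot use an edge at \<open>w\<close>.
\<close>

lemma reach_minus_edge:
  assumes z: "z \<in> V" and "x \<in> V" "x \<noteq> w" "d z x \<le> d z w"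
  shows "(z, x) \<in> (E - {(u, w), (w, u)})\<^sup>*"
  using assms(2-)
proof (induction "d z x" arbitrary: x rule: less_induct)
  case less
  show ?case
  proof (cases "x = z")
    case False
    then obtain y where y: "(y, x) \<in> E" "d z x = d z y + 1"
      using d_pred z less.prems by metis
    then have "y \<in> V" "y \<noteq> w"
      using arcs_in less.prems by auto
    then have "(z, y) \<in> (E - {(u, w), (w, u)})\<^sup>*"
      using less y by auto
    moreover have "(y, x) \<in> E - {(u, w), (w, u)}"
      using y less.prems \<open>y \<noteq> w\<close> by auto
    ultimately show ?thesis
      by (rule rtrancl_into_rtrancl)
  qed simp
qed

lemma bridge_in: "bridge u w \<Longrightarrow> u \<in> V" "bridge u w \<Longrightarrow> w \<in> V" "bridge u w \<Longrightarrow> u \<noteq> w"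
  using arcs_in loopless unfolding bridge_def by auto

text \<open>
  If both ends were equally far from \<open>z\<close>, shortest paths to them would avoid the edge and together
  connect its ends. So a bridge splits the vertices into the two sides closer to either end.
\<close>

lemma bridge_side_cases:
  assumes b: "bridge u w" and z: "z \<in> V"
  obtains "d z w = d z u + 1" | "d z u = d z w + 1"
proof -
  have "d z u \<noteq> d z w"
  proof
    assume eq: "d z u = d z w"
    have "(z, u) \<in> (E - {(u, w), (w, u)})\<^sup>*"
      using reach_minus_edge[OF z] bridge_in[OF b] eq by simp
    moreover have "(z, w) \<in> (E - {(u, w), (w, u)})\<^sup>*"
      using reach_minus_edge[OF z, of w u w] bridge_in[OF b] eq by (simp add: insert_commute)
    ultimately show False
      using b reach_minus_edge_sym unfolding bridge_def by (meson rtrancl_trans)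
  qed
  moreover have "d z w \<le> d z u + 1" "d z u \<le> d z w + 1"
    using d_step[OF z] b sym unfolding bridge_def by blast+
  ultimately have "d z w = d z u + 1 \<or> d z u = d z w + 1"
    by linarith
  then show ?thesis
    using that by blast
qed

lemma bridge_side_reach:
  assumes b: "bridge u w" and z: "z \<in> V" and less: "d z u < d z w"
  shows "(z, u) \<in> (E - {(u, w), (w, u)})\<^sup>*"
  using reach_minus_edge[OF z] bridge_in[OF b] less by simp

text \<open>
  The bridge is the only edge between its two sides.
\<close>

lemma bridge_same_side:
  assumes b: "bridge u w" and e: "(z, z') \<in> E" "(z, z') \<notin> {(u, w), (w, u)}"
    and less: "d z u < d z w"
  shows "d z' u < d z' w"
proof (rule ccontr)
  have z: "z \<in> V" "z' \<in> V"
    using e arcs_in by auto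
  assume "\<not> ?thesis"
  then have "d z' w < d z' u"
    by (rule_tac bridge_side_cases[OF b z(2)]) auto
  then have "(z', w) \<in> (E - {(u, w), (w, u)})\<^sup>*"
    using bridge_side_reach[OF bridge_sym[OF b] z(2)] by (simp add: insert_commute)
  then have "(z, w) \<in> (E - {(u, w), (w, u)})\<^sup>*"
    using e by (meson DiffI converse_rtrancl_into_rtrancl)
  moreover have "(u, z) \<in> (E - {(u, w), (w, u)})\<^sup>*"
    using bridge_side_reach[OF b z(1) less] reach_minus_edge_sym by blast
  ultimately show False
    using b unfolding bridge_def by (meson rtrancl_trans)
qed

text \<open>
  Seen from the side of \<open>x\<close>, every path to \<open>y\<close> has to cross the bridge and hence to pass \<open>v\<close>.
\<close>

lemma bridge_beyond:
  assumes b: "bridge v x" and y: "(v, y) \<in> E" "y \<noteq> x" and p: "p \<in> V" "d p x < d p v"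
  shows "d p y = d p v + 1"
proof -
  have "\<not> d p y \<le> d p v"
  proof
    assume le: "d p y \<le> d p v"
    have "y \<noteq> v" "y \<in> V"
      using y arcs_in loopless by auto
    then have "(p, y) \<in> (E - {(x, v), (v, x)})\<^sup>*"
      using reach_minus_edge p le by blast
    moreover have "(y, v) \<in> E - {(x, v), (v, x)}"
      using y sym \<open>y \<noteq> v\<close> by auto
    ultimately have "(p, v) \<in> (E - {(x, v), (v, x)})\<^sup>*"
      by (rule rtrancl_into_rtrancl)
    moreover have "(x, p) \<in> (E - {(x, v), (v, x)})\<^sup>*"
      using bridge_side_reach[OF bridge_sym[OF b] p] reach_minus_edge_sym by blast
    ultimately show False
      using bridge_sym[OF b] unfolding bridge_def by (meson rtrancl_trans)
  qed
  then show ?thesis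
    using d_step[OF p(1) y(1)] by linarith
qed

text \<open>
  On the side of \<open>v\<close> the bridge makes \<open>x\<close> the farther one of the two neighbours, by one step; on the
  side of \<open>x\<close> it is \<open>y\<close> that lies one step beyond \<open>v\<close>.
\<close>

lemma bridge_max:
  assumes b: "bridge v x" and y: "(v, y) \<in> E" "y \<noteq> x" and p: "p \<in> V"
  shows "d p v + 1 = max (d p x) (d p y)"
  using bridge_side_cases[OF b p]
proof cases
  case 1
  then show ?thesis
    using d_step[OF p y(1)] by simp
next
  case 2
  then show ?thesis
    using bridge_beyond[OF b y p] by simp
qed

lemma resolves_remove:
  assumes S: "resolves S" and b: "bridge v x" and y: "(v, y) \<in> E" "y \<noteq> x"
    and "x \<in> S" "y \<in> S"
  shows "resolves (S - {v})"
  unfolding resolves_def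
proof (intro conjI ballI impI)
  show "S - {v} \<subseteq> V"
    using S unfolding resolves_def by blast
  fix p q assume pq: "p \<in> V" "q \<in> V" and eq: "\<forall>z\<in>S - {v}. d p z = d q z"
  have "x \<noteq> v" "y \<noteq> v"
    using bridge_in[OF b] y loopless by auto
  then have "d p x = d q x" "d p y = d q y"
    using eq assms(5,6) by blast+
  then have "d p v + 1 = d q v + 1"
    using bridge_max[OF b y] pq by simp
  then have "d p v = d q v"
    by simp
  then have "\<forall>z\<in>S. d p z = d q z"
    using eq by blast
  then show "p = q"
    using S pq unfolding resolves_def by blast
qed

end

section \<open>Cycles of a graph\<close>

definition cycle_arcs :: "'a list \<Rightarrow> 'a rel" where
  "cycle_arcs cs = {(cs ! i, cs ! (Suc i mod length cs)) | i. i < length cs}"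

lemma length_vwalk_arcs: "length (vwalk_arcs xs) = length xs - 1"
  by (induction xs rule: vwalk_arcs.induct) auto

lemma nth_vwalk_arcs: "Suc i < length xs \<Longrightarrow> vwalk_arcs xs ! i = (xs ! i, xs ! Suc i)"
proof (induction xs arbitrary: i rule: vwalk_arcs.induct)
  case (3 x y xs)
  then show ?case
    by (cases i) auto
qed auto

lemma set_vwalk_arcs: "set (vwalk_arcs xs) = {(xs ! i, xs ! Suc i) | i. Suc i < length xs}"
proof (rule set_eqI)
  fix e
  have "e \<in> set (vwalk_arcs xs) \<longleftrightarrow> (\<exists>i. i < length xs - 1 \<and> vwalk_arcs xs ! i = e)"
    by (simp add: in_set_conv_nth length_vwalk_arcs)
  also have "\<dots> \<longleftrightarrow> (\<exists>i. e = (xs ! i, xs ! Suc i) \<and> Suc i < length xs)"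
    by (metis nth_vwalk_arcs less_diff_conv Suc_eq_plus1)
  finally show "e \<in> set (vwalk_arcs xs) \<longleftrightarrow> e \<in> {(xs ! i, xs ! Suc i) | i. Suc i < length xs}"
    by simp
qed

lemma set_vwalk_arcs_closed:
  assumes "cs \<noteq> []"
  shows "set (vwalk_arcs (cs @ [hd cs])) = cycle_arcs cs"
proof -
  have "(cs @ [hd cs]) ! Suc i = cs ! (Suc i mod length cs)" if "i < length cs" for i
    using that assms by (cases "Suc i = length cs") (auto simp: nth_append hd_conv_nth)
  then show ?thesis
    unfolding set_vwalk_arcs cycle_arcs_def by (fastforce simp: nth_append)
qed

lemma cycle_graph_simps:
  assumes "cs \<noteq> []"
  shows "pverts (cycle_graph cs) = set cs"
    and "parcs (cycle_graph cs) = cycle_arcs cs \<union> (cycle_arcs cs)\<inverse>"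
  using assms by (auto simp: cycle_graph_def parcs_mk_symmetric set_vwalk_arcs_closed)

lemma rtrancl_distinct_path:
  assumes "(u, w) \<in> R\<^sup>*"
  obtains xs where "xs \<noteq> []" "hd xs = u" "last xs = w" "distinct xs" "set (vwalk_arcs xs) \<subseteq> R"
proof -
  have "\<exists>xs. xs \<noteq> [] \<and> hd xs = u \<and> last xs = w \<and> distinct xs \<and> set (vwalk_arcs xs) \<subseteq> R"
    using assms
  proof (induction rule: converse_rtrancl_induct)
    case base
    have "hd [w] = w \<and> last [w] = w \<and> distinct [w] \<and> set (vwalk_arcs [w]) \<subseteq> R"
      by simp
    then show ?case
      by blast
  next
    case (step u v)
    then obtain xs where xs: "xs \<noteq> []" "hd xs = v" "last xs = w" "distinct xs"
      "set (vwalk_arcs xs) \<subseteq> R"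
      by blast
    show ?case
    proof (cases "u \<in> set xs")
      case True
      then obtain as bs where split: "xs = as @ u # bs"
        by (auto simp: in_set_conv_decomp)
      have "set (vwalk_arcs (u # bs)) \<subseteq> set (vwalk_arcs xs)"
        unfolding split by (cases "as = []") (auto simp: vwalk_arcs_append)
      then have "hd (u # bs) = u \<and> last (u # bs) = w \<and> distinct (u # bs) \<and>
          set (vwalk_arcs (u # bs)) \<subseteq> R"
        using xs split by auto
      then show ?thesis
        by blast
    next
      case False
      then have "hd (u # xs) = u \<and> last (u # xs) = w \<and> distinct (u # xs) \<and>
          set (vwalk_arcs (u # xs)) \<subseteq> R"
        using xs step by auto
      then show ?thesis
        by blast
    qed
  qed
  then show ?thesis
    using that by blast
qed

context conn_graph
begin

lemma cycle_graph_in_cycles_of: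
  assumes "distinct cs" "3 \<le> length cs" "set (vwalk_arcs (cs @ [hd cs])) \<subseteq> parcs G"
  shows "cycle_graph cs \<in> cycles_of G"
proof -
  have ne: "cs \<noteq> []"
    using assms by auto
  have "cs ! i \<in> pverts G" if "i < length cs" for i
    using that assms(3) arcs_in unfolding set_vwalk_arcs_closed[OF ne] cycle_arcs_def by blast
  then have "set cs \<subseteq> pverts G"
    by (auto simp: in_set_conv_nth)
  moreover have "cycle_arcs cs \<subseteq> set cs \<times> set cs"
    using ne by (auto simp: cycle_arcs_def)
  moreover have "wf_digraph (with_proj G)"
    using pair_graph unfolding wf_digraph_wp_iff
    by (simp add: pair_graph_def pair_digraph_def pair_fin_digraph_def)
  moreover have arcs: "parcs (cycle_graph cs) \<subseteq> parcs G"
    using assms(3) sym unfolding cycle_graph_simps[OF ne] set_vwalk_arcs_closed[OF ne] by blast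
  moreover have "pair_wf_digraph (cycle_graph cs)"
    using \<open>cycle_arcs cs \<subseteq> set cs \<times> set cs\<close>
    by unfold_locales (auto simp: cycle_graph_simps[OF ne])
  ultimately have "subgraph (with_proj (cycle_graph cs)) (with_proj G)"
    unfolding subgraph_def wf_digraph_wp_iff
    by (simp add: cycle_graph_simps(1)[OF ne] compatible_def)
  then show ?thesis
    using assms unfolding cycles_of_def by blast
qed

text \<open>
  A path that connects the ends of the edge without using it closes up with this edge to a second
  cycle.
\<close>

lemma unique_cycle_bridge:
  assumes unique: "\<And>C'. C' \<in> cycles_of G \<Longrightarrow> C' = C"
    and e: "(u, w) \<in> parcs G" "(u, w) \<notin> parcs C"
  shows "bridge u w"
proof (rule ccontr)
  assume "\<not> bridge u w"
  then have "(u, w) \<in> (parcs G - {(u, w), (w, u)})\<^sup>*"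
    using e by (simp add: bridge_def)
  then obtain xs where xs: "xs \<noteq> []" "hd xs = u" "last xs = w" "distinct xs"
    "set (vwalk_arcs xs) \<subseteq> parcs G - {(u, w), (w, u)}"
    by (rule rtrancl_distinct_path)
  have "u \<noteq> w"
    using e loopless by auto
  have closed: "vwalk_arcs (xs @ [hd xs]) = vwalk_arcs xs @ [(w, u)]"
    using xs by (simp add: vwalk_arcs_append)
  have "3 \<le> length xs"
  proof (rule ccontr)
    assume "\<not> ?thesis"
    then consider a where "xs = [a]" | a b where "xs = [a, b]"
      using xs(1) by (cases xs; cases "tl xs"; cases "tl (tl xs)") auto
    then show False
      using xs \<open>u \<noteq> w\<close> by cases auto
  qed
  then have "cycle_graph xs \<in> cycles_of G"
    using xs closed e sym by (intro cycle_graph_in_cycles_of) auto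
  then have "cycle_graph xs = C"
    by (rule unique)
  moreover have "(w, u) \<in> cycle_arcs xs"
    using xs closed set_vwalk_arcs_closed[OF xs(1)] by (metis in_set_conv_decomp)
  ultimately show False
    using e cycle_graph_simps(2)[OF xs(1)] by auto
qed

end

section \<open>Trees hanging on the unique cycle\<close>

lemma shift_mod_image:
  fixes k N :: nat
  assumes "0 < N"
  shows "(\<lambda>i. (k + i) mod N) ` {..<N} = {..<N}"
proof
  show "{..<N} \<subseteq> (\<lambda>i. (k + i) mod N) ` {..<N}"
  proof
    fix j assume j: "j \<in> {..<N}"
    have "(k + (j + k * (N - 1)) mod N) mod N = (j + k * (1 + (N - 1))) mod N"
      by (simp add: mod_simps algebra_simps)
    also have "\<dots> = j"
      using assms j by simp
    finally show "j \<in> (\<lambda>i. (k + i) mod N) ` {..<N}"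
      using assms by (metis (no_types, lifting) image_eqI lessThan_iff mod_less_divisor)
  qed
qed (use assms in auto)

lemma cycle_arcs_image: "cycle_arcs cs = (\<lambda>i. (cs ! i, cs ! (Suc i mod length cs))) ` {..<length cs}"
  unfolding cycle_arcs_def by auto

lemma cycle_arcs_rotate [simp]: "cycle_arcs (rotate k cs) = cycle_arcs cs"
proof (cases "cs = []")
  case False
  let ?N = "length cs"
  have "cycle_arcs (rotate k cs) =
      (\<lambda>i. (cs ! i, cs ! (Suc i mod ?N))) ` ((\<lambda>i. (k + i) mod ?N) ` {..<?N})"
    unfolding cycle_arcs_image image_image using False
    by (intro image_cong) (simp_all add: nth_rotate mod_simps)
  then show ?thesis
    using False shift_mod_image[of "length cs" k] by (simp add: cycle_arcs_image[of cs])
qed simp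

text \<open>
  The structure of a unicyclic graph, expressed through bridges: removing an edge outside the cycle
  \<open>cs\<close> separates its ends.
\<close>

locale ucycle = ugraph +
  fixes cs :: "'a list"
  assumes dist: "distinct cs" and len: "3 \<le> length cs"
    and cycle_arcs_sub: "cycle_arcs cs \<subseteq> E"
    and bridgeI: "(u, w) \<in> E \<Longrightarrow> (u, w) \<notin> cycle_arcs cs \<union> (cycle_arcs cs)\<inverse> \<Longrightarrow> bridge u w"
begin

abbreviation "N \<equiv> length cs"
abbreviation "D \<equiv> cycle_arcs cs \<union> (cycle_arcs cs)\<inverse>"

lemma ucycle_rotate: "ucycle V E (rotate k cs)"
  by unfold_locales (use dist len cycle_arcs_sub bridgeI in auto)

lemma D_sub: "D \<subseteq> E"
  using cycle_arcs_sub sym by auto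

lemma N_pos: "0 < N"
  using len by linarith

lemma D_in: "(u, w) \<in> D \<Longrightarrow> u \<in> set cs \<and> w \<in> set cs"
  using mod_less_divisor[OF N_pos] by (auto simp: cycle_arcs_def)

lemma next_D: "i < N \<Longrightarrow> (cs ! i, cs ! (Suc i mod N)) \<in> D"
  by (auto simp: cycle_arcs_def)

lemma prev_D: 
  assumes "i < N"
  shows "(cs ! i, cs ! ((i + (N - 1)) mod N)) \<in> D"
proof -
  define j where "j = (i + (N - 1)) mod N"
  have "Suc j mod N = Suc (i + (N - 1)) mod N"
    unfolding j_def by (simp add: mod_Suc_eq)
  also have "Suc (i + (N - 1)) = i + N"
    using N_pos by simp
  finally have "Suc j mod N = (i + N) mod N" .
  then have "Suc j mod N = i"
    using assms by simp
  moreover have "j < N"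
    unfolding j_def by (rule mod_less_divisor[OF N_pos])
  ultimately show ?thesis
    using next_D[of j] unfolding j_def[symmetric] by auto
qed

lemma next_neq_prev: 
  assumes "i < N"
  shows "cs ! (Suc i mod N) \<noteq> cs ! ((i + (N - 1)) mod N)"
proof -
  have "Suc i mod N \<noteq> (i + (N - 1)) mod N"
    using assms len by (cases "Suc i = N"; cases "i = 0") (auto simp: mod_if)
  moreover have "Suc i mod N < N" "(i + (N - 1)) mod N < N"
    by (intro mod_less_divisor N_pos)+
  ultimately show ?thesis
    using dist by (simp add: nth_eq_iff_index_eq)
qed

lemma set_cs_V: "set cs \<subseteq> V"
  using next_D D_sub arcs_in by (fastforce simp: in_set_conv_nth)

lemma D_neighbours_0:
  assumes "(cs ! 0, y) \<in> D"
  shows "y = cs ! 1 \<or> y = cs ! (N - 1)"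
proof -
  have "\<exists>i < N. (cs ! 0 = cs ! i \<and> y = cs ! (Suc i mod N)) \<or>
      (y = cs ! i \<and> cs ! 0 = cs ! (Suc i mod N))"
    using assms by (auto simp: cycle_arcs_def)
  then obtain i where i: "i < N"
    "(cs ! 0 = cs ! i \<and> y = cs ! (Suc i mod N)) \<or> (y = cs ! i \<and> cs ! 0 = cs ! (Suc i mod N))"
    by blast
  have "0 < N" "Suc i mod N < N"
    using mod_less_divisor N_pos by blast+
  then have eq: "cs ! 0 = cs ! i \<longleftrightarrow> i = 0" "cs ! 0 = cs ! (Suc i mod N) \<longleftrightarrow> Suc i mod N = 0"
    using dist i(1) nth_eq_iff_index_eq by metis+
  show ?thesis
    using i(2)
  proof
    assume "cs ! 0 = cs ! i \<and> y = cs ! (Suc i mod N)"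
    then show ?thesis
      using eq len by simp
  next
    assume a: "y = cs ! i \<and> cs ! 0 = cs ! (Suc i mod N)"
    then have "Suc i = N"
      using eq i(1) by (metis Suc_lessI mod_less nat.simps(3))
    then have "i = N - 1"
      by simp
    then show ?thesis
      using a by blast
  qed
qed

text \<open>
  Going around the cycle never crosses a bridge that is not a cycle edge.
\<close>

lemma cycle_same_side:
  assumes e: "(u, w) \<in> E" "(u, w) \<notin> D" and c: "c \<in> set cs" "d c u < d c w" and c': "c' \<in> set cs"
  shows "d c' u < d c' w"
proof -
  let ?P = "\<lambda>i. d (cs ! i) u < d (cs ! i) w"
  have b: "bridge u w"
    using e by (rule bridgeI)
  have step: "?P i \<longleftrightarrow> ?P (Suc i)" if "Suc i < N" for i
  proof -
    have "(cs ! i, cs ! Suc i) \<in> D"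
      using next_D[of i] that by simp
    then have "(cs ! i, cs ! Suc i) \<in> E" "(cs ! i, cs ! Suc i) \<notin> {(u, w), (w, u)}"
      "(cs ! Suc i, cs ! i) \<in> E" "(cs ! Suc i, cs ! i) \<notin> {(u, w), (w, u)}"
      using e D_sub by auto
    then show ?thesis
      using bridge_same_side[OF b] by blast
  qed
  have iff0: "?P i \<longleftrightarrow> ?P 0" if "i < N" for i
    using that
  proof (induction i)
    case (Suc i)
    then show ?case
      using step[of i] by simp
  qed simp
  then show ?thesis
    using c c' by (metis in_set_conv_nth)
qed

lemma cycle_far_side:
  assumes e: "(u, w) \<in> E" "(u, w) \<notin> D"
  obtains "\<And>c. c \<in> set cs \<Longrightarrow> d c w = d c u + 1" | "\<And>c. c \<in> set cs \<Longrightarrow> d c u = d c w + 1"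
proof -
  have b: "bridge u w" and e': "(w, u) \<in> E" "(w, u) \<notin> D"
    using e bridgeI sym by auto
  obtain c where c: "c \<in> set cs"
    using len by (metis list.set_sel(1) list.size(3) not_numeral_le_zero)
  have one: "d c' w = d c' u + 1 \<or> d c' u = d c' w + 1" if "c' \<in> set cs" for c'
    using bridge_side_cases[OF b] that set_cs_V by blast
  show ?thesis
  proof (cases "d c u < d c w")
    case True
    then have "d c' w = d c' u + 1" if "c' \<in> set cs" for c'
      using one[OF that] cycle_same_side[OF e c _ that] by auto
    then show ?thesis
      using that by blast
  next
    case False
    then have "d c w < d c u"
      using one[OF c] by auto
    then have "d c' u = d c' w + 1" if "c' \<in> set cs" for c'
      using one[OF that] cycle_same_side[OF e' c _ that] by auto
    then show ?thesis
      using that by blast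
  qed
qed

text \<open>
  A cycle vertex nearest to \<open>v\<close> is on a shortest path from \<open>v\<close> to any cycle vertex. A first step
  from \<open>v\<close> towards it crosses a bridge with the whole cycle on the far side, so it reduces all
  distances to the cycle by the same amount.
\<close>

lemma gate_exists:
  assumes "v \<in> V"
  shows "\<exists>c\<in>set cs. \<forall>c'\<in>set cs. d v c' = d v c + d c c'"
proof -
  have gate: "\<forall>c'\<in>set cs. d v c' = k + d c c'"
    if "v \<in> V" "c \<in> set cs" "d v c = k" "\<forall>c'\<in>set cs. k \<le> d v c'" for k v c
    using that
  proof (induction k arbitrary: v)
    case 0
    then show ?case
      using d_eq_0 set_cs_V by auto
  next
    case (Suc k)
    have cV: "c \<in> V" "c \<noteq> v"
      using Suc.prems set_cs_V by auto
    then obtain u where u: "(u, v) \<in> E" "d c v = d c u + 1"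
      using d_pred[of c v] Suc.prems by metis
    have "v \<notin> set cs"
      using Suc.prems(4) by fastforce
    then have "(u, v) \<notin> D"
      using D_in by blast
    have far: "d c' v = d c' u + 1" if "c' \<in> set cs" for c'
      using cycle_far_side[OF u(1) \<open>(u, v) \<notin> D\<close>]
    proof cases
      case 2
      then have "d c u = d c v + 1"
        using Suc.prems(2) by blast
      then show ?thesis
        using u(2) by simp
    qed (use that in blast)
    have "\<forall>c'\<in>set cs. d u c' = k + d c c'"
    proof (rule Suc.IH)
      show "u \<in> V"
        using u arcs_in by auto
      show "d u c = k"
        using u Suc.prems(3) by (simp add: d_sym)
      show "\<forall>c'\<in>set cs. k \<le> d u c'"
      proof
        fix c' assume "c' \<in> set cs"
        then show "k \<le> d u c'"
          using far Suc.prems(4) by (simp add: d_sym)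
      qed
    qed (rule Suc.prems)
    then show ?case
      using far by (simp add: d_sym)
  qed
  have "d v ` set cs \<noteq> {}"
    using N_pos by auto
  then have "Min (d v ` set cs) \<in> d v ` set cs"
    by (intro Min_in) auto
  then obtain c where c: "c \<in> set cs" "Min (d v ` set cs) = d v c"
    by blast
  have "d v c \<le> d v c'" if "c' \<in> set cs" for c'
    unfolding c(2)[symmetric] using that by simp
  then show ?thesis
    using gate[OF assms] c by blast
qed

text \<open>
  The cycle vertex at which the tree containing \<open>v\<close> hangs. It is specified by distances so that
  \<open>d_root\<close> is available at once; \<open>root_eqI\<close> shows that it is unique.
\<close>

definition root :: "'a \<Rightarrow> 'a" where
  "root v = (SOME c. c \<in> set cs \<and> (\<forall>c'\<in>set cs. d v c' = d v c + d c c'))"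

definition height :: "'a \<Rightarrow> nat" where
  "height v = d v (root v)"

lemma root_spec:
  assumes "v \<in> V"
  shows "root v \<in> set cs \<and> (\<forall>c'\<in>set cs. d v c' = d v (root v) + d (root v) c')"
  unfolding root_def by (rule someI_ex) (use gate_exists[OF assms] in blast)

lemma root_in: "v \<in> V \<Longrightarrow> root v \<in> set cs"
  using root_spec by blast

lemma d_root: "v \<in> V \<Longrightarrow> c \<in> set cs \<Longrightarrow> d v c = height v + d (root v) c"
  unfolding height_def using root_spec by blast

lemma root_eqI:
  assumes v: "v \<in> V" and c: "c \<in> set cs" and eq: "\<And>c'. c' \<in> set cs \<Longrightarrow> d v c' = k + d c c'"
  shows "root v = c \<and> height v = k"
proof -
  have "height v + d (root v) c = k" "height v = k + d c (root v)"
    using d_root[OF v c] eq[OF c] d_root[OF v root_in[OF v]] eq[OF root_in[OF v]] by simp_all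
  then have "d c (root v) = 0"
    by linarith
  then have "c = root v"
    using d_eq_0 c root_in[OF v] set_cs_V by blast
  then show ?thesis
    using \<open>height v + d (root v) c = k\<close> by simp
qed

lemma root_cycle: "c \<in> set cs \<Longrightarrow> root c = c" "c \<in> set cs \<Longrightarrow> height c = 0"
  using root_eqI[of c c 0] set_cs_V by (simp_all add: subset_iff)

lemma height_0: "v \<in> V \<Longrightarrow> height v = 0 \<longleftrightarrow> v \<in> set cs"
  using d_eq_0[of v "root v"] root_in[of v] set_cs_V root_cycle[of v] unfolding height_def
  by (metis subsetD)

text \<open>
  A bridge changes the distances to all cycle vertices by one in the same direction.
\<close>

lemma root_edge:
  assumes e: "(u, w) \<in> E" "(u, w) \<notin> D"
  shows "root u = root w \<and> (height w = height u + 1 \<or> height u = height w + 1)"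
proof -
  have V: "u \<in> V" "w \<in> V"
    using e arcs_in by auto
  show ?thesis
    using cycle_far_side[OF e]
  proof cases
    case 1
    then have "d w c = height u + 1 + d (root u) c" if "c \<in> set cs" for c
      using that d_root[OF V(1)] by (simp add: d_sym)
    then show ?thesis
      using root_eqI[OF V(2) root_in[OF V(1)]] by simp
  next
    case 2
    then have "d u c = height w + 1 + d (root w) c" if "c \<in> set cs" for c
      using that d_root[OF V(2)] by (simp add: d_sym)
    then show ?thesis
      using root_eqI[OF V(1) root_in[OF V(2)]] by simp
  qed
qed

lemma parent:
  assumes v: "v \<in> V" "height v = Suc k"
  obtains u where "(u, v) \<in> E" "(u, v) \<notin> D" "root u = root v" "height u = k"
proof -
  have r: "root v \<in> set cs" "root v \<in> V"
    using root_in v set_cs_V by auto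
  have notin: "v \<notin> set cs"
    using v root_cycle by auto
  then obtain u where u: "(u, v) \<in> E" "d (root v) v = d (root v) u + 1"
    using d_pred[of "root v" v] r v by metis
  have "(u, v) \<notin> D"
    using notin D_in by blast
  then have ru: "root u = root v" "height v = height u + 1 \<or> height u = height v + 1"
    using root_edge u by auto
  have "height u = d (root v) u"
    unfolding height_def using ru by (simp add: d_sym)
  then have "height u = k"
    using u(2) v(2) unfolding height_def by (simp add: d_sym)
  then show ?thesis
    using that u \<open>(u, v) \<notin> D\<close> ru by blast
qed

text \<open>
  The two cycle neighbours of the root of \<open>z\<close> are equally far from \<open>z\<close>. So no single vertex is a
  resolving set.
\<close>

lemma not_inj_on_cycle:
  assumes z: "z \<in> V"
  shows "\<exists>x\<in>V. \<exists>y\<in>V. x \<noteq> y \<and> d x z = d y z"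
proof -
  obtain i where i: "i < N" "root z = cs ! i"
    using root_in[OF z] by (metis in_set_conv_nth)
  let ?x = "cs ! (Suc i mod N)" and ?y = "cs ! ((i + (N - 1)) mod N)"
  have "?x \<in> set cs" "?y \<in> set cs"
    using next_D[OF i(1)] prev_D[OF i(1)] D_in by blast+
  moreover have "d (root z) ?x = 1" "d (root z) ?y = 1"
    using d_adj next_D[OF i(1)] prev_D[OF i(1)] D_sub i(2) by auto
  ultimately show ?thesis
    using d_root[OF z] next_neq_prev[OF i(1)] set_cs_V by (metis d_sym subsetD)
qed

lemma resolves_card_ge_2:
  assumes S: "resolves S"
  shows "2 \<le> card S"
proof (rule ccontr)
  assume "\<not> 2 \<le> card S"
  moreover have "finite S"
    using S fin finite_subset unfolding resolves_def by blast
  ultimately consider "S = {}" | z where "S = {z}"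
    using card_1_singletonE[of S] card_0_eq[of S] by (metis One_nat_def Suc_1 less_2_cases not_less)
  then show False
  proof cases
    case 1
    have "cs ! 0 \<in> V"
      using N_pos set_cs_V nth_mem by blast
    then show False
      using not_inj_on_cycle S 1 unfolding resolves_def by blast
  next
    case 2
    then show False
      using not_inj_on_cycle[of z] S unfolding resolves_def by auto
  qed
qed

text \<open>
  Otherwise no path within \<open>S\<close> would leave \<open>{t, t'}\<close>, although \<open>S\<close> is larger and connected.
\<close>

lemma third_vertex:
  assumes S: "conn_on S" "3 \<le> card S" and t: "t \<in> S" "t' \<in> S"
  obtains y where "y \<in> S" "y \<noteq> t" "y \<noteq> t'" "(t, y) \<in> E \<or> (t', y) \<in> E"
proof -
  have "\<not> S \<subseteq> {t, t'}"
  proof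
    assume "S \<subseteq> {t, t'}"
    then have "card S \<le> card {t, t'}"
      by (intro card_mono) auto
    also have "\<dots> \<le> 2"
      by (simp add: card_insert_if)
    finally show False
      using S(2) by simp
  qed
  then obtain y where y: "y \<in> S" "y \<noteq> t" "y \<noteq> t'"
    by blast
  have "y \<in> {t, t'} \<or> (\<exists>y\<in>S. y \<noteq> t \<and> y \<noteq> t' \<and> ((t, y) \<in> E \<or> (t', y) \<in> E))"
    if "(t, y) \<in> (E \<inter> S \<times> S)\<^sup>*" for y
    using that
  proof (induction rule: rtrancl_induct)
    case (step y z)
    then show ?case
      by blast
  qed simp
  then show ?thesis
    using that S(1) y t unfolding conn_on_def by blast
qed

text \<open>
  An edge of the induced graph outside the cycle would be a bridge with a further neighbour in \<open>S\<close> at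
  one of its ends, and that end could be removed by \<open>resolves_remove\<close>.
\<close>

lemma minimal_edges_on_cycle:
  assumes S: "resolves S" "conn_on S" "3 \<le> card S"
    and min: "\<And>v. v \<in> S \<Longrightarrow> \<not> resolves (S - {v})"
    and t: "t \<in> S" "t' \<in> S" "(t, t') \<in> E"
  shows "(t, t') \<in> D"
proof (rule ccontr)
  assume nD: "(t, t') \<notin> D"
  then have b: "bridge t t'" "bridge t' t"
    using bridgeI t bridge_sym by blast+
  obtain y where y: "y \<in> S" "y \<noteq> t" "y \<noteq> t'" "(t, y) \<in> E \<or> (t', y) \<in> E"
    using third_vertex S t by blast
  then show False
    using resolves_remove[OF S(1) b(1)] resolves_remove[OF S(1) b(2)] min t by blast
qed

lemma minimal_on_cycle:
  assumes S: "resolves S" "conn_on S" "3 \<le> card S"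
    and min: "\<And>v. v \<in> S \<Longrightarrow> \<not> resolves (S - {v})"
  shows "S \<subseteq> set cs"
proof
  fix t assume t: "t \<in> S"
  obtain y where "y \<in> S" "(t, y) \<in> E"
    using third_vertex[OF S(2,3) t t] by blast
  then show "t \<in> set cs"
    using minimal_edges_on_cycle[OF S min t] D_in by blast
qed

text \<open>
  Rotating the cycle moves the middle one of the three vertices to position \<open>0\<close>.
\<close>

lemma minimal_consecutive:
  assumes S: "resolves S" "conn_on S" "3 \<le> card S"
    and min: "\<And>v. v \<in> S \<Longrightarrow> \<not> resolves (S - {v})"
  obtains k where "{rotate k cs ! 0, rotate k cs ! 1, rotate k cs ! (N - 1)} \<subseteq> S"
proof -
  obtain t where t: "t \<in> S"
    using S(2) unfolding conn_on_def by blast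
  obtain t' where t': "t' \<in> S" "t' \<noteq> t" "(t, t') \<in> E"
    using third_vertex[OF S(2,3) t t] by blast
  obtain y where y: "y \<in> S" "y \<noteq> t" "y \<noteq> t'" "(t, y) \<in> E \<or> (t', y) \<in> E"
    using third_vertex[OF S(2,3) t t'(1)] by blast
  obtain v x y where v: "v \<in> S" "x \<in> S" "y \<in> S" "x \<noteq> y" "(v, x) \<in> E" "(v, y) \<in> E"
    using y t t' sym by metis
  then have D: "(v, x) \<in> D" "(v, y) \<in> D"
    using minimal_edges_on_cycle[OF S min] by blast+
  then obtain k where k: "k < N" "cs ! k = v"
    using D_in by (metis in_set_conv_nth)
  interpret R: ucycle V E "rotate k cs"
    by (rule ucycle_rotate)
  have v0: "rotate k cs ! 0 = v"
    using k nth_rotate[of 0 cs k] N_pos by simp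
  have "x = rotate k cs ! 1 \<or> x = rotate k cs ! (N - 1)"
    "y = rotate k cs ! 1 \<or> y = rotate k cs ! (N - 1)"
    using R.D_neighbours_0[of x] R.D_neighbours_0[of y] D v0 by auto
  then have "{rotate k cs ! 0, rotate k cs ! 1, rotate k cs ! (N - 1)} \<subseteq> S"
    using v v0 by auto
  then show ?thesis
    by (rule that)
qed

text \<open>
  If the edge joining the two vertices were a bridge, the whole cycle would lie on one side of it, and
  the two vertices would separate exactly the pairs of cycle vertices that one of them separates.
\<close>

lemma adjacent_pair:
  assumes S: "resolves S" "conn_on S" "card S = 2"
  obtains k where "S = {rotate k cs ! 0, rotate k cs ! 1}"
proof -
  obtain a b where ab: "S = {a, b}" "a \<noteq> b"
    using S(3) by (meson card_2_iff)
  have "(a, b) \<in> (E \<inter> S \<times> S)\<^sup>*"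
    using S ab unfolding conn_on_def by blast
  then obtain y where "(a, y) \<in> E" "y \<in> S"
    using ab(2) by (cases rule: converse_rtranclE) blast+
  then have e: "(a, b) \<in> E"
    using ab loopless by blast
  have V: "a \<in> V" "b \<in> V"
    using e arcs_in by auto
  have "(a, b) \<in> D"
  proof (rule ccontr)
    assume nD: "(a, b) \<notin> D"
    obtain i where i: "i < N" "root a = cs ! i"
      using root_in[OF V(1)] by (metis in_set_conv_nth)
    let ?x = "cs ! (Suc i mod N)" and ?y = "cs ! ((i + (N - 1)) mod N)"
    have xy: "?x \<in> set cs" "?y \<in> set cs"
      using next_D[OF i(1)] prev_D[OF i(1)] D_in by blast+
    moreover have "d (root a) ?x = 1" "d (root a) ?y = 1"
      using d_adj next_D[OF i(1)] prev_D[OF i(1)] D_sub i(2) by auto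
    ultimately have da: "d ?x a = d ?y a"
      using d_root[OF V(1)] by (metis d_sym)
    then have "d ?x b = d ?y b"
      by (rule_tac cycle_far_side[OF e nD]) (use xy in \<open>metis add_right_cancel\<close>)+
    then show False
      using S(1) da next_neq_prev[OF i(1)] set_cs_V xy ab unfolding resolves_def by blast
  qed
  then obtain k where "k < N"
    "(a, b) = (cs ! k, cs ! (Suc k mod N)) \<or> (b, a) = (cs ! k, cs ! (Suc k mod N))"
    by (auto simp: cycle_arcs_def)
  then have "S = {rotate k cs ! 0, rotate k cs ! 1}"
    using ab nth_rotate[of 0 cs k] nth_rotate[of 1 cs k] len N_pos by (auto simp: insert_commute)
  then show ?thesis
    by (rule that)
qed

end

section \<open>Branches resolved from the cycle are paths\<close>

definition sun_arcs :: "'a list \<Rightarrow> (nat \<Rightarrow> 'a list) \<Rightarrow> 'a rel" where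
  "sun_arcs cs P = cycle_arcs cs \<union> (\<Union>i<length cs. set (vwalk_arcs (cs ! i # P i)))"

lemma sun_graph_simps:
  assumes "cs \<noteq> []"
  shows "pverts (sun_graph cs P) = set cs \<union> (\<Union>i<length cs. set (P i))"
    and "parcs (sun_graph cs P) = sun_arcs cs P \<union> (sun_arcs cs P)\<inverse>"
proof -
  show "pverts (sun_graph cs P) = set cs \<union> (\<Union>i<length cs. set (P i))"
    by (simp add: sun_graph_def)
  have "parcs (sun_graph cs P) = (\<Union>e\<in>sun_arcs cs P. {(fst e, snd e), (snd e, fst e)})"
    using assms by (simp add: sun_graph_def parcs_mk_symmetric sun_arcs_def set_vwalk_arcs_closed)
  also have "\<dots> = sun_arcs cs P \<union> (sun_arcs cs P)\<inverse>"
    by auto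
  finally show "parcs (sun_graph cs P) = sun_arcs cs P \<union> (sun_arcs cs P)\<inverse>" .
qed

context ucycle
begin

lemma root_height_inj:
  assumes S: "resolves S" "S \<subseteq> set cs"
    and uv: "u \<in> V" "v \<in> V" "root u = root v" "height u = height v"
  shows "u = v"
proof -
  have "\<forall>z\<in>S. d u z = d v z"
    using d_root[OF uv(1)] d_root[OF uv(2)] uv S(2) by (simp add: subset_iff)
  then show ?thesis
    using S(1) uv unfolding resolves_def by blast
qed

lemma ancestor:
  assumes "v \<in> V" "h \<le> height v"
  shows "\<exists>u\<in>V. root u = root v \<and> height u = h"
  using assms
proof (induction "height v" arbitrary: v)
  case 0
  then show ?case
    by auto
next
  case (Suc k)
  obtain u where u: "(u, v) \<in> E" "root u = root v" "height u = k"
    using parent[OF Suc.prems(1) Suc.hyps(2)[symmetric]] by metis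
  then have "u \<in> V"
    using arcs_in by blast
  show ?case
  proof (cases "h = Suc k")
    case True
    then show ?thesis
      using Suc by auto
  next
    case False
    then have "h \<le> height u"
      using Suc.hyps(2) Suc.prems(2) u(3) by simp
    then show ?thesis
      using Suc.hyps(1)[of u] u \<open>u \<in> V\<close> by auto
  qed
qed

text \<open>
  Over each cycle vertex there is at most one vertex of each height, and heights occur without gaps,
  because a vertex of positive height has a neighbour one lower over the same root. Listing a branch by
  height gives the path, and edges outside the cycle join consecutive heights.
\<close>

lemma resolved_from_cycle_is_sun:
  assumes S: "resolves S" "S \<subseteq> set cs"
  shows "\<exists>P. (\<forall>i<N. distinct (P i) \<and> set (P i) \<inter> set cs = {}) \<and>
    disjoint_family_on (\<lambda>i. set (P i)) {..<N} \<and>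
    V = set cs \<union> (\<Union>i<N. set (P i)) \<and> E = sun_arcs cs P \<union> (sun_arcs cs P)\<inverse>"
proof -
  define B where "B i = {v \<in> V. root v = cs ! i}" for i
  define L where "L i = Max (height ` B i)" for i
  define f where "f i h = (THE v. v \<in> B i \<and> height v = h)" for i h
  define P where "P i = map (f i) [1..<Suc (L i)]" for i
  have finB: "finite (B i)" for i
    using fin by (simp add: B_def)
  have csV: "cs ! i \<in> V" if "i < N" for i
    using that set_cs_V nth_mem by blast
  have csB: "cs ! i \<in> B i" "height (cs ! i) = 0" if "i < N" for i
    using that csV root_cycle by (auto simp: B_def)
  have le_L: "height v \<le> L i" if "v \<in> B i" for i v
    unfolding L_def using that finB by simp
  have inj: "u = v" if "u \<in> B i" "v \<in> B i" "height u = height v" for i u v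
    using that root_height_inj[OF S] by (simp add: B_def)
  have f_eq: "f i (height v) = v" if "v \<in> B i" for i v
    unfolding f_def using that inj by blast
  have f_in: "f i h \<in> B i \<and> height (f i h) = h" if i: "i < N" and h: "h \<le> L i" for i h
  proof -
    have "L i \<in> height ` B i"
      unfolding L_def using finB csB[OF i] by (intro Max_in) auto
    then obtain v where "v \<in> B i" "h \<le> height v"
      using h by (metis imageE)
    then obtain u where "u \<in> B i" "height u = h"
      using ancestor[of v h] by (auto simp: B_def)
    then show ?thesis
      using f_eq by metis
  qed
  have f0: "f i 0 = cs ! i" if "i < N" for i
    using f_eq[OF csB(1)[OF that]] csB(2)[OF that] by simp
  have branch: "cs ! i # P i = map (f i) [0..<Suc (L i)]" if "i < N" for i
    unfolding P_def using f0[OF that] by (simp add: upt_conv_Cons del: upt_Suc)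
  have set_P: "set (P i) = {v \<in> B i. height v \<noteq> 0}" if "i < N" for i
  proof -
    have "set (P i) = f i ` {h. 1 \<le> h \<and> h \<le> L i}"
      unfolding P_def by auto
    also have "\<dots> = {v \<in> B i. height v \<noteq> 0}"
    proof
      show "f i ` {h. 1 \<le> h \<and> h \<le> L i} \<subseteq> {v \<in> B i. height v \<noteq> 0}"
        using f_in[OF that] by auto
      show "{v \<in> B i. height v \<noteq> 0} \<subseteq> f i ` {h. 1 \<le> h \<and> h \<le> L i}"
      proof
        fix v assume v: "v \<in> {v \<in> B i. height v \<noteq> 0}"
        then have "v = f i (height v)" "1 \<le> height v" "height v \<le> L i"
          using f_eq le_L by auto
        then show "v \<in> f i ` {h. 1 \<le> h \<and> h \<le> L i}"
          by blast
      qed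
    qed
    finally show ?thesis .
  qed
  have arcs_P: "set (vwalk_arcs (cs ! i # P i)) = {(f i h, f i (Suc h)) | h. Suc h \<le> L i}"
    if "i < N" for i
  proof -
    have "map (f i) [0..<Suc (L i)] ! h = f i h" if "h \<le> L i" for h
      using that by (simp del: upt_Suc)
    then have "e = (map (f i) [0..<Suc (L i)] ! h, map (f i) [0..<Suc (L i)] ! Suc h) \<and>
          Suc h < length (map (f i) [0..<Suc (L i)]) \<longleftrightarrow>
        e = (f i h, f i (Suc h)) \<and> Suc h \<le> L i" for e h
      by (cases "Suc h \<le> L i") (simp_all del: upt_Suc)
    then show ?thesis
      unfolding branch[OF that] set_vwalk_arcs by (intro Collect_cong iff_exI)
  qed
  have "distinct (P i)" if "i < N" for i
  proof -
    have "inj_on (f i) {1..<Suc (L i)}"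
      using f_in[OF that] by (intro inj_onI) (metis atLeastLessThan_iff less_Suc_eq_le)
    then show ?thesis
      unfolding P_def distinct_map by (simp del: upt_Suc)
  qed
  moreover have "set (P i) \<inter> set cs = {}" if "i < N" for i
    using set_P[OF that] root_cycle by auto
  moreover have "disjoint_family_on (\<lambda>i. set (P i)) {..<N}"
    using set_P dist by (auto simp: disjoint_family_on_def B_def nth_eq_iff_index_eq)
  moreover have "V = set cs \<union> (\<Union>i<N. set (P i))"
  proof
    show "V \<subseteq> set cs \<union> (\<Union>i<N. set (P i))"
    proof
      fix v assume v: "v \<in> V"
      then obtain i where i: "i < N" "root v = cs ! i"
        using root_in by (metis in_set_conv_nth)
      then show "v \<in> set cs \<union> (\<Union>i<N. set (P i))"
        using v set_P[OF i(1)] height_0[OF v] by (auto simp: B_def)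
    qed
    show "set cs \<union> (\<Union>i<N. set (P i)) \<subseteq> V"
      using set_cs_V set_P by (auto simp: B_def)
  qed
  moreover have "E = sun_arcs cs P \<union> (sun_arcs cs P)\<inverse>"
  proof
    have up: "(u, w) \<in> sun_arcs cs P" if e: "(u, w) \<in> E" "(u, w) \<notin> D" "height w = height u + 1" for u w
    proof -
      have V: "u \<in> V" "w \<in> V"
        using e arcs_in by auto
      then obtain i where i: "i < N" "root u = cs ! i"
        using root_in by (metis in_set_conv_nth)
      then have B: "u \<in> B i" "w \<in> B i"
        using V root_edge[OF e(1,2)] by (auto simp: B_def)
      then have "(u, w) = (f i (height u), f i (Suc (height u)))" "Suc (height u) \<le> L i"
        using f_eq e(3) le_L by (metis Suc_eq_plus1)+
      then have "(u, w) \<in> set (vwalk_arcs (cs ! i # P i))"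
        unfolding arcs_P[OF i(1)] by blast
      then show ?thesis
        unfolding sun_arcs_def using i(1) by blast
    qed
    show "E \<subseteq> sun_arcs cs P \<union> (sun_arcs cs P)\<inverse>"
    proof
      fix e assume e: "e \<in> E"
      obtain u w where uw: "e = (u, w)"
        by fastforce
      show "e \<in> sun_arcs cs P \<union> (sun_arcs cs P)\<inverse>"
      proof (cases "e \<in> D")
        case True
        then show ?thesis
          unfolding sun_arcs_def by blast
      next
        case False
        moreover have "(w, u) \<in> E" "(w, u) \<notin> D"
          using e uw False sym by auto
        ultimately show ?thesis
          using up[of u w] up[of w u] root_edge[of u w] e uw by auto
      qed
    qed
    have "(f i h, f i (Suc h)) \<in> E" if i: "i < N" and h: "Suc h \<le> L i" for i h
    proof -
      have v: "f i (Suc h) \<in> B i" "height (f i (Suc h)) = Suc h"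
        using f_in[OF i h] by auto
      then have "f i (Suc h) \<in> V"
        by (simp add: B_def)
      then obtain u where u: "(u, f i (Suc h)) \<in> E" "root u = root (f i (Suc h))" "height u = h"
        using parent[OF _ v(2)] by metis
      then have "u \<in> B i"
        using v arcs_in by (auto simp: B_def)
      then show ?thesis
        using f_eq u by metis
    qed
    then have "sun_arcs cs P \<subseteq> E"
      unfolding sun_arcs_def using arcs_P cycle_arcs_sub by auto
    then show "sun_arcs cs P \<union> (sun_arcs cs P)\<inverse> \<subseteq> E"
      using sym by auto
  qed
  ultimately show ?thesis
    by blast
qed

end

section \<open>Distances on a cycle\<close>

text \<open>
  The distance between positions \<open>i\<close> and \<open>j\<close> on a cycle of length \<open>N\<close>.
\<close>

definition cycle_dist :: "nat \<Rightarrow> nat \<Rightarrow> nat \<Rightarrow> nat" where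
  "cycle_dist N i j = (if i \<le> j then min (j - i) (i + N - j) else min (i - j) (j + N - i))"

lemma cycle_dist_self [simp]: "cycle_dist N i i = 0"
  by (simp add: cycle_dist_def)

text \<open>
  The four ways to go from \<open>i\<close> to \<open>j\<close>: in either direction, with or without passing position \<open>0\<close>.
  They are stated without subtraction for the sake of linear arithmetic.
\<close>

lemma cycle_dist_cases:
  assumes "i < N" "j < N"
  obtains "i + cycle_dist N i j = j" "2 * cycle_dist N i j \<le> N"
  | "j + cycle_dist N i j = i" "2 * cycle_dist N i j \<le> N"
  | "j + cycle_dist N i j = i + N" "2 * cycle_dist N i j \<le> N"
  | "i + cycle_dist N i j = j + N" "2 * cycle_dist N i j \<le> N"
proof (cases "i \<le> j")
  case True
  then have "cycle_dist N i j = min (j - i) (i + N - j)"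
    by (simp add: cycle_dist_def)
  then show ?thesis
    using that(1,3) True assms by (cases "j - i \<le> i + N - j") auto
next
  case False
  then have "cycle_dist N i j = min (i - j) (j + N - i)"
    by (simp add: cycle_dist_def)
  then show ?thesis
    using that(2,4) False assms by (cases "i - j \<le> j + N - i") auto
qed

lemma Suc_mod_cases: "i < N \<Longrightarrow> Suc i mod N = (if Suc i = N then 0 else Suc i)"
  for i N :: nat by (simp add: mod_if)

lemma cycle_dist_Suc_le:
  assumes "i < N" "j < N"
  shows "cycle_dist N (Suc i mod N) j \<le> cycle_dist N i j + 1"
    and "cycle_dist N i j \<le> cycle_dist N (Suc i mod N) j + 1"
proof -
  define k where "k = Suc i mod N"
  have "k = Suc i \<or> k = 0 \<and> Suc i = N" and k: "k < N"
    using assms by (auto simp: k_def Suc_mod_cases)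
  then have "cycle_dist N k j \<le> cycle_dist N i j + 1 \<and> cycle_dist N i j \<le> cycle_dist N k j + 1"
    by (elim disjE conjE; rule_tac cycle_dist_cases[OF assms]; rule_tac cycle_dist_cases[OF k assms(2)];
      intro conjI; linarith)
  then show "cycle_dist N (Suc i mod N) j \<le> cycle_dist N i j + 1"
    "cycle_dist N i j \<le> cycle_dist N (Suc i mod N) j + 1"
    by (auto simp: k_def)
qed

lemma cycle_dist_closer:
  assumes "i < N" "j < N" "i \<noteq> j"
  shows "cycle_dist N (Suc i mod N) j < cycle_dist N i j \<or>
    (\<exists>i'<N. Suc i' mod N = i \<and> cycle_dist N i' j < cycle_dist N i j)"
proof -
  define k where "k = Suc i mod N"
  define i' where "i' = (if i = 0 then N - 1 else i - 1)"
  have i': "i' < N" "Suc i' mod N = i"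
    using assms by (auto simp: i'_def Suc_mod_cases)
  have k: "k = Suc i \<or> k = 0 \<and> Suc i = N" "k < N"
    using assms by (auto simp: k_def Suc_mod_cases)
  have prev: "i = Suc i' \<or> i = 0 \<and> Suc i' = N"
    using assms by (auto simp: i'_def)
  have ij: "i < j \<or> j < i"
    using assms(3) by linarith
  have "cycle_dist N k j < cycle_dist N i j \<or> cycle_dist N i' j < cycle_dist N i j"
    using assms(1,2)
  proof (cases rule: cycle_dist_cases)
    case 1
    then have "cycle_dist N k j < cycle_dist N i j"
      using k(1) ij assms by (elim disjE conjE; rule_tac cycle_dist_cases[OF k(2) assms(2)]; linarith)
    then show ?thesis ..
  next
    case 2
    then have "cycle_dist N i' j < cycle_dist N i j"
      using prev ij assms by (elim disjE conjE; rule_tac cycle_dist_cases[OF i'(1) assms(2)]; linarith)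
    then show ?thesis ..
  next
    case 3
    then have "cycle_dist N i' j < cycle_dist N i j"
      using prev ij assms by (elim disjE conjE; rule_tac cycle_dist_cases[OF i'(1) assms(2)]; linarith)
    then show ?thesis ..
  next
    case 4
    then have "cycle_dist N k j < cycle_dist N i j"
      using k(1) ij assms by (elim disjE conjE; rule_tac cycle_dist_cases[OF k(2) assms(2)]; linarith)
    then show ?thesis ..
  qed
  then show ?thesis
    using i' k_def by blast
qed

text \<open>
  The positions at which a path spoils the resolving power of the edge between positions \<open>0\<close> and
  \<open>1\<close>. The other ones are the two (\<open>N\<close> even) or three (\<open>N\<close> odd) positions opposite to that edge; on a
  triangle these are all positions, including \<open>0\<close>.
\<close>

definition blocked :: "nat \<Rightarrow> nat \<Rightarrow> bool" where
  "blocked N i \<longleftrightarrow> i = 0 \<and> N \<noteq> 3 \<or> 1 \<le> i \<and> 2 * i + 2 \<le> N \<or> N + 3 < 2 * i"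

text \<open>
  The two halves of the cycle as seen from the edge between positions \<open>0\<close> and \<open>1\<close>. The middle case
  \<open>opposite\<close> occurs only on an odd cycle.
\<close>

lemma pair_cases:
  assumes "i < N" "3 \<le> N"
  obtains (right) "1 \<le> i" "2 * i \<le> N" "cycle_dist N i 0 = i" "cycle_dist N i 1 + 1 = i"
  | (opposite) "2 * i = N + 1" "cycle_dist N i 0 + 1 = i" "cycle_dist N i 1 + 1 = i"
  | (left) "N + 1 < 2 * i" "cycle_dist N i 0 + i = N" "cycle_dist N i 1 = cycle_dist N i 0 + 1"
  | (zero) "i = 0" "cycle_dist N i 0 = 0" "cycle_dist N i 1 = 1"
proof -
  have N: "0 < N" "1 < N"
    using assms by auto
  consider "i = 0" | "1 \<le> i" "2 * i \<le> N" | "2 * i = N + 1" | "N + 1 < 2 * i"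
    by linarith
  then show ?thesis
  proof cases
    case 1
    then show ?thesis
      using assms by (intro zero) (auto simp: cycle_dist_def)
  next
    case 2
    then show ?thesis
      using assms by (intro right) (auto simp: cycle_dist_def)
  next
    case 3
    then show ?thesis
      using assms by (intro opposite) (auto simp: cycle_dist_def)
  next
    case 4
    then show ?thesis
      using assms by (intro left) (auto simp: cycle_dist_def)
  qed
qed

text \<open>
  The difference of the two distances tells apart the halves and, on an odd cycle, the position opposite
  to the edge. Within a half \<open>h\<close> plus the distance to
  the edge is known, and this determines the vertex if \<open>h\<close> can be positive only at the last position
  of the half.
\<close>

lemma pair_separates:
  assumes N: "3 \<le> N" and i: "i < N" "i' < N"
    and b: "blocked N i \<longrightarrow> h = 0" "blocked N i' \<longrightarrow> h' = 0"
    and eq: "h + cycle_dist N i 0 = h' + cycle_dist N i' 0" "h + cycle_dist N i 1 = h' + cycle_dist N i' 1"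
  shows "i = i' \<and> h = h'"
proof -
  have cases: "1 \<le> i \<and> 2 * i \<le> N \<and> cycle_dist N i 0 = i \<and> cycle_dist N i 1 + 1 = i \<and>
        (h = 0 \<or> N \<le> 2 * i + 1) \<or>
      2 * i = N + 1 \<and> cycle_dist N i 0 + 1 = i \<and> cycle_dist N i 1 + 1 = i \<or>
      N + 1 < 2 * i \<and> cycle_dist N i 0 + i = N \<and> cycle_dist N i 1 = cycle_dist N i 0 + 1 \<and>
        (h = 0 \<or> 2 * i \<le> N + 3) \<or>
      i = 0 \<and> cycle_dist N i 0 = 0 \<and> cycle_dist N i 1 = 1 \<and> (h = 0 \<or> N = 3)"
    if i: "i < N" and b: "blocked N i \<longrightarrow> h = 0" for i h
    using b unfolding blocked_def by (rule_tac pair_cases[OF i N]; auto)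
  have "\<not> i < i'" "\<not> i' < i"
    using cases[OF i(1) b(1)] cases[OF i(2) b(2)] eq i by (elim disjE conjE; linarith)+
  then show ?thesis
    using eq by (cases "i = i'") auto
qed

text \<open>
  Positions \<open>0\<close> and \<open>1\<close> tell the two halves of the cycle apart, and within a half the distances to
  position \<open>0\<close> and to the opposite position \<open>m\<close> run in opposite directions, so that their difference
  determines the position.
\<close>

lemma triple_separates:
  assumes N: "3 \<le> N" and i: "i < N" "i' < N"
    and m: "2 * m = N \<or> 2 * m = N + 1"
    and eq: "h + cycle_dist N i 0 = h' + cycle_dist N i' 0" "h + cycle_dist N i 1 = h' + cycle_dist N i' 1"
      "h + cycle_dist N i m = h' + cycle_dist N i' m"
  shows "i = i' \<and> h = h'"
proof -
  have mid: "cycle_dist N i m = (if i = 0 then N - m else if i \<le> m then m - i else i - m)" if "i < N" for i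
    using that m N by (auto simp: cycle_dist_def)
  have "i = i'"
    using eq m mid[OF i(1)] mid[OF i(2)] i
    by (rule_tac pair_cases[OF i(1) N]; rule_tac pair_cases[OF i(2) N]; simp split: if_splits)
  then show ?thesis
    using eq by simp
qed

text \<open>
  Here \<open>a\<close> and \<open>b\<close> are the lengths of the paths at positions \<open>0\<close> and \<open>m\<close>, and the two distances are
  those to their ends. Up to \<open>a + b\<close>, the sum of the distances is \<open>m\<close> on the path between the two ends,
  \<open>m + 2 * h\<close> over its inner cycle vertices, and \<open>N - m + 2 * h\<close> over the remaining cycle vertices. The
  latter two can agree only if \<open>N = 2 * m + 2\<close> and \<open>h > 0\<close> over an inner vertex; but positive \<open>h\<close> is
  possible only over \<open>0\<close> and near the position opposite to \<open>0\<close>. Within each of these regions the sum and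
  the difference of the distances determine the vertex.
\<close>

lemma leaves_separate:
  fixes a b :: nat
  assumes N: "4 \<le> N" and i: "i < N" "i' < N" and m: "N = 2 * m + 1 \<or> N = 2 * m + 2"
    and h: "i = 0 \<longrightarrow> h \<le> a" "i' = 0 \<longrightarrow> h' \<le> a" "i = m \<longrightarrow> h \<le> b" "i' = m \<longrightarrow> h' \<le> b"
    and near: "1 \<le> i \<and> 2 * i + 4 \<le> N \<or> N + 4 \<le> 2 * i \<longrightarrow> h = 0"
      "1 \<le> i' \<and> 2 * i' + 4 \<le> N \<or> N + 4 \<le> 2 * i' \<longrightarrow> h' = 0"
    and eq: "(if i = 0 then a - h else h + a + cycle_dist N i 0) =
        (if i' = 0 then a - h' else h' + a + cycle_dist N i' 0)"
      "(if i = m then b - h else h + b + cycle_dist N i m) =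
        (if i' = m then b - h' else h' + b + cycle_dist N i' m)"
  shows "i = i' \<and> h = h'"
proof -
  define x where "x i h = (if i = 0 then a - h else h + a + cycle_dist N i 0)" for i h
  define y where "y i h = (if i = m then b - h else h + b + cycle_dist N i m)" for i h
  have cases: "i = 0 \<and> x i h + h = a \<and> y i h = h + b + m \<or>
      1 \<le> i \<and> i < m \<and> x i h = h + a + i \<and> y i h + i = h + b + m \<and> (h = 0 \<or> N \<le> 2 * i + 3) \<or>
      i = m \<and> x i h = h + a + m \<and> y i h + h = b \<or>
      m < i \<and> x i h + i = h + a + N \<and> y i h + m = h + b + i \<and> (h = 0 \<or> 2 * i \<le> N + 3)"
    if "i < N" and "i = 0 \<longrightarrow> h \<le> a" "i = m \<longrightarrow> h \<le> b"
      "1 \<le> i \<and> 2 * i + 4 \<le> N \<or> N + 4 \<le> 2 * i \<longrightarrow> h = 0" for i h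
  proof -
    have "cycle_dist N i 0 = (if i \<le> m then i else N - i)"
      "cycle_dist N i m = (if i \<le> m then m - i else i - m)" "1 \<le> m"
      using that(1) m N by (auto simp: cycle_dist_def)
    then show ?thesis
      using that N by (cases "i = 0"; cases "i < m"; cases "i = m") (auto simp: x_def y_def)
  qed
  have less: "\<not> i < i'" if i: "i < N" "i' < N"
      and h: "i = 0 \<longrightarrow> h \<le> a" "i' = 0 \<longrightarrow> h' \<le> a" "i = m \<longrightarrow> h \<le> b" "i' = m \<longrightarrow> h' \<le> b"
      and near: "1 \<le> i \<and> 2 * i + 4 \<le> N \<or> N + 4 \<le> 2 * i \<longrightarrow> h = 0"
        "1 \<le> i' \<and> 2 * i' + 4 \<le> N \<or> N + 4 \<le> 2 * i' \<longrightarrow> h' = 0"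
      and eq: "x i h = x i' h'" "y i h = y i' h'"
    for i i' h h'
  proof
    assume lt: "i < i'"
    consider "i = 0" | "1 \<le> i" "i < m" | "i = m" | "m < i"
      by linarith
    then show False
    proof cases
      case 1
      then show False
        using lt eq m N i cases[OF i(1) h(1,3) near(1)] cases[OF i(2) h(2,4) near(2)] by linarith
    next
      case 2
      have I: "x i h = h + a + i" "y i h + i = h + b + m" "h = 0 \<or> N \<le> 2 * i + 3"
        using cases[OF i(1) h(1,3) near(1)] 2 by linarith+
      consider "i' < m" | "i' = m" | "m < i'"
        by linarith
      then show False
      proof cases
        case 1
        then show False
          using lt eq m I cases[OF i(2) h(2,4) near(2)] by linarith
      next
        case 2
        then show False
          using lt eq m I cases[OF i(2) h(2,4) near(2)] by linarith
      next
        case 3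
        then have "x i' h' + i' = h' + a + N" "y i' h' + m = h' + b + i'"
          using cases[OF i(2) h(2,4) near(2)] lt by linarith+
        then have "2 * h + 2 * m = 2 * h' + N"
          using I eq by linarith
        then have "N = 2 * m + 2" "h = h' + 1"
          using m by presburger+
        then show False
          using I 2 by linarith
      qed
    next
      case 3
      then show False
        using lt eq m N i cases[OF i(1) h(1,3) near(1)] cases[OF i(2) h(2,4) near(2)] by linarith
    next
      case 4
      then show False
        using lt eq m N i cases[OF i(1) h(1,3) near(1)] cases[OF i(2) h(2,4) near(2)] by linarith
    qed
  qed
  have xy: "x i h = x i' h'" "y i h = y i' h'"
    using eq by (simp_all add: x_def y_def)
  have "i = i'"
    using less[OF i h near xy] less[OF i(2,1) h(2,1,4,3) near(2,1) xy[symmetric]] by linarith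
  moreover have "h = h'" if "i = i'"
    using xy cases[OF i(1) h(1,3) near(1)] cases[OF i(2) h(2,4) near(2)] that by linarith
  ultimately show ?thesis
    by blast
qed

section \<open>Resolving sets of suns\<close>

text \<open>
  The branch at the cycle vertex \<open>cs ! i\<close> is the path \<open>cs ! i # P i\<close>. A vertex of a sun is given by
  its coordinates, the index \<open>i\<close> of the branch and the height \<open>h\<close> in it, with \<open>h = 0\<close> on the cycle.
\<close>

locale sun = ugraph +
  fixes cs :: "'a list" and P :: "nat \<Rightarrow> 'a list"
  assumes dist: "distinct cs" and len: "3 \<le> length cs"
    and dist_P: "i < length cs \<Longrightarrow> distinct (P i)"
    and P_off_cycle: "i < length cs \<Longrightarrow> set (P i) \<inter> set cs = {}"
    and disjoint_P: "disjoint_family_on (\<lambda>i. set (P i)) {..<length cs}"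
    and V_eq: "V = set cs \<union> (\<Union>i<length cs. set (P i))"
    and E_eq: "E = sun_arcs cs P \<union> (sun_arcs cs P)\<inverse>"
begin

abbreviation "N \<equiv> length cs"

definition pt :: "nat \<Rightarrow> nat \<Rightarrow> 'a" where
  "pt i h = (cs ! i # P i) ! h"

abbreviation valid :: "nat \<Rightarrow> nat \<Rightarrow> bool" where
  "valid i h \<equiv> i < N \<and> h \<le> length (P i)"

lemma N_pos: "0 < N"
  using len by linarith

lemma pt_0 [simp]: "pt i 0 = cs ! i"
  by (simp add: pt_def)

lemma pt_in_branch: "valid i h \<Longrightarrow> h \<noteq> 0 \<Longrightarrow> pt i h \<in> set (P i)"
  by (cases h) (auto simp: pt_def)

lemma pt_V: "valid i h \<Longrightarrow> pt i h \<in> V"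
  using pt_in_branch[of i h] by (cases "h = 0") (auto simp: V_eq)

lemma V_pt:
  assumes "v \<in> V"
  obtains i h where "valid i h" "v = pt i h"
proof -
  consider "v \<in> set cs" | i where "i < N" "v \<in> set (P i)"
    using assms by (auto simp: V_eq)
  then show ?thesis
  proof cases
    case 1
    then obtain i where "i < N" "v = cs ! i"
      by (metis in_set_conv_nth)
    then show ?thesis
      using that[of i 0] by simp
  next
    case 2
    then obtain h where "h < length (P i)" "v = P i ! h"
      by (metis in_set_conv_nth)
    then show ?thesis
      using that[of i "Suc h"] 2 by (simp add: pt_def)
  qed
qed

lemma pt_inj:
  assumes v: "valid i h" "valid j l" and eq: "pt i h = pt j l"
  shows "i = j \<and> h = l"
proof -
  consider "h = 0" "l = 0" | "h = 0" "l \<noteq> 0" | "h \<noteq> 0" "l = 0" | "h \<noteq> 0" "l \<noteq> 0"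
    by blast
  then show ?thesis
  proof cases
    case 1
    then show ?thesis
      using assms dist by (simp add: nth_eq_iff_index_eq)
  next
    case 2
    then have "cs ! i \<in> set (P j)"
      using assms pt_in_branch[of j l] by auto
    moreover have "cs ! i \<in> set cs"
      using v by simp
    ultimately show ?thesis
      using P_off_cycle[of j] v by blast
  next
    case 3
    then have "cs ! j \<in> set (P i)"
      using assms pt_in_branch[of i h] by auto
    moreover have "cs ! j \<in> set cs"
      using v by simp
    ultimately show ?thesis
      using P_off_cycle[of i] v by blast
  next
    case 4
    then have "pt i h \<in> set (P i)" "pt i h \<in> set (P j)"
      using v pt_in_branch eq by metis+
    then have "i = j"
      using disjoint_P v unfolding disjoint_family_on_def by blast
    moreover have "distinct (P i)"
      using v dist_P by blast
    ultimately show ?thesis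
      using 4 v eq by (cases h; cases l) (auto simp: pt_def nth_eq_iff_index_eq)
  qed
qed

lemma sun_arcs_iff:
  "(u, v) \<in> sun_arcs cs P \<longleftrightarrow> (\<exists>i<N. u = pt i 0 \<and> v = pt (Suc i mod N) 0) \<or>
    (\<exists>i<N. \<exists>h<length (P i). u = pt i h \<and> v = pt i (Suc h))"
proof -
  have "(u, v) \<in> set (vwalk_arcs (cs ! i # P i)) \<longleftrightarrow> (\<exists>h<length (P i). u = pt i h \<and> v = pt i (Suc h))" for i
    unfolding set_vwalk_arcs pt_def by auto
  then show ?thesis
    unfolding sun_arcs_def cycle_arcs_def by auto
qed

lemma E_cycle: "i < N \<Longrightarrow> (pt i 0, pt (Suc i mod N) 0) \<in> E"
  and E_branch: "i < N \<Longrightarrow> h < length (P i) \<Longrightarrow> (pt i h, pt i (Suc h)) \<in> E"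
  unfolding E_eq using sun_arcs_iff by blast+

lemma E_cases:
  assumes "(u, v) \<in> E"
  obtains (cycle) i where "i < N" "u = pt i 0 \<and> v = pt (Suc i mod N) 0 \<or> v = pt i 0 \<and> u = pt (Suc i mod N) 0"
  | (branch) i h where "i < N" "h < length (P i)" "u = pt i h \<and> v = pt i (Suc h) \<or> v = pt i h \<and> u = pt i (Suc h)"
  using assms unfolding E_eq Un_iff converse_iff sun_arcs_iff by blast

definition sun_dist :: "nat \<Rightarrow> nat \<Rightarrow> nat \<Rightarrow> nat \<Rightarrow> nat" where
  "sun_dist i h j l = (if i = j then (if h \<le> l then l - h else h - l) else h + l + cycle_dist N i j)"

lemma sun_dist_0: "sun_dist i h j 0 = h + cycle_dist N i j" "sun_dist i 0 j l = l + cycle_dist N i j"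
  by (auto simp: sun_dist_def)

text \<open>
  The explicit formula satisfies the hypotheses of \<open>d_eq_potential\<close>, where the function of the
  vertices that is required there is read off from the coordinates.
\<close>

lemma d_pt:
  assumes v: "valid i h" and z: "valid j l"
  shows "d (pt i h) (pt j l) = sun_dist i h j l"
proof -
  define f where "f v = (THE k. \<exists>i h. valid i h \<and> v = pt i h \<and> k = sun_dist i h j l)" for v
  have f: "f (pt i h) = sun_dist i h j l" if "valid i h" for i h
    unfolding f_def
  proof (rule the_equality)
    show "\<exists>i' h'. valid i' h' \<and> pt i h = pt i' h' \<and> sun_dist i h j l = sun_dist i' h' j l"
      using that by blast
    fix k assume "\<exists>i' h'. valid i' h' \<and> pt i h = pt i' h' \<and> k = sun_dist i' h' j l"
    then show "k = sun_dist i h j l"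
      using pt_inj that by blast
  qed
  have lip: "f v \<le> f u + 1" if "(u, v) \<in> E" for u v
    using that
  proof (cases rule: E_cases)
    case (cycle i)
    then have "valid i 0" "valid (Suc i mod N) 0"
      using N_pos by auto
    then show ?thesis
      using cycle(2) cycle_dist_Suc_le[of i N j] z by (elim disjE conjE) (auto simp: f sun_dist_0 simp del: pt_0)
  next
    case (branch i h)
    then have "valid i h" "valid i (Suc h)"
      by auto
    then show ?thesis
      using branch(3) by (elim disjE conjE) (auto simp: f sun_dist_def simp del: pt_0)
  qed
  have down: "\<exists>u. (u, v) \<in> E \<and> f u < f v" if "v \<in> V" "v \<noteq> pt j l" for v
  proof -
    obtain i h where v: "valid i h" "v = pt i h"
      using V_pt[OF \<open>v \<in> V\<close>] .
    have ne: "i \<noteq> j \<or> h \<noteq> l"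
      using that v by auto
    consider "i = j" "h < l" | h' where "h = Suc h'" "i \<noteq> j \<or> l < h" | "i \<noteq> j" "h = 0"
      using ne by (cases h) (auto, linarith)
    then show ?thesis
    proof cases
      case 1
      then have "(pt i (Suc h), pt i h) \<in> E" "f (pt i (Suc h)) < f (pt i h)"
        using E_branch[of i h] sym v z by (auto simp: f sun_dist_def simp del: pt_0)
      then show ?thesis
        using v by blast
    next
      case 2
      then have "(pt i h', pt i h) \<in> E" "f (pt i h') < f (pt i h)"
        using E_branch[of i h'] v z by (auto simp: f sun_dist_def simp del: pt_0)
      then show ?thesis
        using v by blast
    next
      case 3
      have val: "valid i' 0" if "i' < N" for i'
        using that by simp
      have "cycle_dist N (Suc i mod N) j < cycle_dist N i j \<or>
          (\<exists>i'<N. Suc i' mod N = i \<and> cycle_dist N i' j < cycle_dist N i j)"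
        using cycle_dist_closer 3 v z by blast
      then show ?thesis
      proof (elim disjE exE conjE)
        assume "cycle_dist N (Suc i mod N) j < cycle_dist N i j"
        then have "f (pt (Suc i mod N) 0) < f (pt i 0)"
          using f[OF val] v N_pos by (simp add: sun_dist_0 del: pt_0)
        then show ?thesis
          using E_cycle[of i] sym v 3 by blast
      next
        fix i' assume i': "i' < N" "Suc i' mod N = i" "cycle_dist N i' j < cycle_dist N i j"
        then have "f (pt i' 0) < f (pt i 0)"
          using f[OF val] v N_pos by (simp add: sun_dist_0 del: pt_0)
        then show ?thesis
          using E_cycle[of i'] i' v 3 by blast
      qed
    qed
  qed
  have "d (pt j l) (pt i h) = f (pt i h)"
    using pt_V v z by (intro d_eq_potential lip down) (auto simp: f sun_dist_def simp del: pt_0)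
  then show ?thesis
    using f[OF v] d_sym by simp
qed

lemma resolves_ptsI:
  assumes Z: "\<And>j l. (j, l) \<in> Z \<Longrightarrow> valid j l"
    and sep: "\<And>i h i' h'. valid i h \<Longrightarrow> valid i' h' \<Longrightarrow>
      \<forall>(j, l)\<in>Z. sun_dist i h j l = sun_dist i' h' j l \<Longrightarrow> i = i' \<and> h = h'"
  shows "resolves ((\<lambda>(j, l). pt j l) ` Z)"
  unfolding resolves_def
proof (intro conjI ballI impI)
  show "(\<lambda>(j, l). pt j l) ` Z \<subseteq> V"
    using Z pt_V by fastforce
  fix x y assume "x \<in> V" "y \<in> V" and eq: "\<forall>z\<in>(\<lambda>(j, l). pt j l) ` Z. d x z = d y z"
  obtain i h where x: "valid i h" "x = pt i h"
    using V_pt[OF \<open>x \<in> V\<close>] .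
  obtain i' h' where y: "valid i' h'" "y = pt i' h'"
    using V_pt[OF \<open>y \<in> V\<close>] .
  have "sun_dist i h j l = sun_dist i' h' j l" if "(j, l) \<in> Z" for j l
    using eq that d_pt[OF x(1) Z[OF that]] d_pt[OF y(1) Z[OF that]] x y by force
  then show "x = y"
    using sep[OF x(1) y(1)] x y by blast
qed

lemma resolves_ptsD:
  assumes "resolves S" and S: "\<forall>z\<in>S. \<exists>(j, l)\<in>Z. valid j l \<and> z = pt j l"
    and v: "valid i h" "valid i' h'" and eq: "\<forall>(j, l)\<in>Z. sun_dist i h j l = sun_dist i' h' j l"
  shows "i = i' \<and> h = h'"
proof -
  have "\<forall>z\<in>S. d (pt i h) z = d (pt i' h') z"
    using S eq d_pt[OF v(1)] d_pt[OF v(2)] by fastforce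
  then have "pt i h = pt i' h'"
    using \<open>resolves S\<close> pt_V v unfolding resolves_def by blast
  then show ?thesis
    using pt_inj v by blast
qed

lemma edge_resolves:
  assumes "\<And>i. i < N \<Longrightarrow> blocked N i \<Longrightarrow> P i = []"
  shows "resolves {cs ! 0, cs ! 1}"
proof -
  have "resolves ((\<lambda>(j, l). pt j l) ` {(0, 0), (1, 0)})"
  proof (rule resolves_ptsI)
    show "valid j l" if "(j, l) \<in> {(0, 0), (1, 0)}" for j l
      using that len by auto
    fix i h i' h'
    assume v: "valid i h" "valid i' h'"
      and eq: "\<forall>(j, l)\<in>{(0, 0), (1, 0)}. sun_dist i h j l = sun_dist i' h' j l"
    have "blocked N i \<longrightarrow> h = 0" "blocked N i' \<longrightarrow> h' = 0"
      using assms[of i] assms[of i'] v by auto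
    then show "i = i' \<and> h = h'"
      using eq v len by (intro pair_separates[of N]) (auto simp: sun_dist_0)
  qed
  then show ?thesis
    by simp
qed

text \<open>
  The first vertex of a path at a blocked position has the same distances to both ends of the edge as
  the next cycle vertex \<open>i'\<close> in the direction away from the edge.
\<close>

lemma edge_resolvesD:
  assumes res: "resolves {cs ! 0, cs ! 1}" and i: "i < N" "blocked N i"
  shows "P i = []"
proof (rule ccontr)
  assume "P i \<noteq> []"
  then have v: "valid i 1"
    using i by (cases "P i") auto
  \<comment> \<open>Position \<open>0\<close> is an end of the edge, and \<open>N - 1\<close> is its neighbour away from the edge.\<close>
  define i' where "i' = (if i = 0 then N - 1 else if 2 * i + 2 \<le> N then i + 1 else i - 1)"
  have v': "valid i' 0"
    using i len by (auto simp: i'_def)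
  have "cycle_dist N i' 0 = 1 + cycle_dist N i 0 \<and> cycle_dist N i' 1 = 1 + cycle_dist N i 1"
    using i len unfolding blocked_def by (elim disjE conjE) (auto simp: i'_def cycle_dist_def min_def)
  then have eq: "\<forall>(j, l)\<in>{(0, 0), (1, 0)}. sun_dist i 1 j l = sun_dist i' 0 j l"
    by (auto simp: sun_dist_0)
  have on_cycle: "\<forall>z\<in>{cs ! 0, cs ! 1}. \<exists>(j, l)\<in>{(0, 0), (1, 0)}. valid j l \<and> z = pt j l"
    using len N_pos by auto
  then show False
    using resolves_ptsD[OF res on_cycle v v' eq] by simp
qed

lemma triple_resolves: "resolves {cs ! 0, cs ! 1, cs ! ((N + 1) div 2)}"
proof -
  have m: "2 * ((N + 1) div 2) = N \<or> 2 * ((N + 1) div 2) = N + 1" "(N + 1) div 2 < N"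
    using len by presburger+
  have "resolves ((\<lambda>(j, l). pt j l) ` {(0, 0), (1, 0), ((N + 1) div 2, 0)})"
  proof (rule resolves_ptsI)
    show "valid j l" if "(j, l) \<in> {(0, 0), (1, 0), ((N + 1) div 2, 0)}" for j l
      using that len m by auto
    fix i h i' h'
    assume "valid i h" "valid i' h'"
      and "\<forall>(j, l)\<in>{(0, 0), (1, 0), ((N + 1) div 2, 0)}. sun_dist i h j l = sun_dist i' h' j l"
    then show "i = i' \<and> h = h'"
      using len m by (intro triple_separates[of N i i' "(N + 1) div 2"]) (auto simp: sun_dist_0)
  qed
  then show ?thesis
    by simp
qed

text \<open>
  As for an edge: the first vertex of a path at \<open>i\<close> would have the same distances to the three
  vertices as the next cycle vertex \<open>i'\<close> in the direction away from them. The bounds on \<open>i\<close> keep \<open>i'\<close>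
  on the same side of all three.
\<close>

lemma path3_resolvesD:
  assumes res: "resolves {cs ! 0, cs ! 1, cs ! (N - 1)}"
    and i: "i < N" "1 \<le> i \<and> 2 * i + 4 \<le> N \<or> N + 4 \<le> 2 * i"
  shows "P i = []"
proof (rule ccontr)
  assume "P i \<noteq> []"
  then have v: "valid i 1"
    using i by (cases "P i") auto
  define i' where "i' = (if 2 * i + 4 \<le> N then i + 1 else i - 1)"
  have v': "valid i' 0"
    using i len by (auto simp: i'_def)
  have "cycle_dist N i' 0 = 1 + cycle_dist N i 0 \<and> cycle_dist N i' 1 = 1 + cycle_dist N i 1 \<and>
      cycle_dist N i' (N - 1) = 1 + cycle_dist N i (N - 1)"
    using i(2)
  proof
    assume near: "1 \<le> i \<and> 2 * i + 4 \<le> N"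
    then have i': "i' = i + 1"
      by (simp add: i'_def)
    have "cycle_dist N i 0 = i" "cycle_dist N i 1 + 1 = i" "cycle_dist N i (N - 1) = i + 1"
      "cycle_dist N i' 0 = i + 1" "cycle_dist N i' 1 = i" "cycle_dist N i' (N - 1) = i + 2"
      using near unfolding i' by (auto simp: cycle_dist_def min_def)
    then show ?thesis
      by linarith
  next
    assume far: "N + 4 \<le> 2 * i"
    then have i': "i' = i - 1"
      by (simp add: i'_def)
    have "cycle_dist N i 0 + i = N" "cycle_dist N i 1 + i = N + 1" "cycle_dist N i (N - 1) + i + 1 = N"
      "cycle_dist N i' 0 + i = N + 1" "cycle_dist N i' 1 + i = N + 2" "cycle_dist N i' (N - 1) + i = N"
      using far i(1) unfolding i' by (auto simp: cycle_dist_def min_def)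
    then show ?thesis
      by linarith
  qed
  then have eq: "\<forall>(j, l)\<in>{(0, 0), (1, 0), (N - 1, 0)}. sun_dist i 1 j l = sun_dist i' 0 j l"
    by (auto simp: sun_dist_0)
  have on_cycle: "\<forall>z\<in>{cs ! 0, cs ! 1, cs ! (N - 1)}. \<exists>(j, l)\<in>{(0, 0), (1, 0), (N - 1, 0)}. valid j l \<and> z = pt j l"
    using len N_pos by auto
  then show False
    using resolves_ptsD[OF res on_cycle v v' eq] by simp
qed

lemma path3_not_optimal:
  assumes N: "4 \<le> N" and res: "resolves {cs ! 0, cs ! 1, cs ! (N - 1)}"
  shows "\<exists>S. resolves S \<and> card S \<le> 2"
proof -
  define m where "m = (N - 1) div 2"
  define Z where "Z = {(0, length (P 0)), (m, length (P m))}"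
  have m: "N = 2 * m + 1 \<or> N = 2 * m + 2" "m < N"
    using N unfolding m_def by presburger+
  have "resolves ((\<lambda>(j, l). pt j l) ` Z)"
  proof (rule resolves_ptsI)
    show "valid j l" if "(j, l) \<in> Z" for j l
      using that N m by (auto simp: Z_def)
    fix i h i' h'
    assume v: "valid i h" "valid i' h'"
      and eq: "\<forall>(j, l)\<in>Z. sun_dist i h j l = sun_dist i' h' j l"
    have near: "1 \<le> i \<and> 2 * i + 4 \<le> N \<or> N + 4 \<le> 2 * i \<longrightarrow> h = 0"
      "1 \<le> i' \<and> 2 * i' + 4 \<le> N \<or> N + 4 \<le> 2 * i' \<longrightarrow> h' = 0"
      using path3_resolvesD[OF res] v by fastforce+
    have leaf: "sun_dist i h j (length (P j)) = (if i = j then length (P j) - h else h + length (P j) + cycle_dist N i j)"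
      if "valid i h" for i h j
      using that by (auto simp: sun_dist_def)
    show "i = i' \<and> h = h'"
    proof (rule leaves_separate[OF N _ _ m(1)])
      show "i < N" "i' < N" "i = 0 \<longrightarrow> h \<le> length (P 0)" "i' = 0 \<longrightarrow> h' \<le> length (P 0)"
        "i = m \<longrightarrow> h \<le> length (P m)" "i' = m \<longrightarrow> h' \<le> length (P m)"
        using v by auto
    qed (use eq near leaf[OF v(1)] leaf[OF v(2)] in \<open>simp_all add: Z_def\<close>)
  qed
  moreover have "card ((\<lambda>(j, l). pt j l) ` Z) \<le> 2"
    using card_image_le[of Z] by (simp add: Z_def card_insert_if split: if_splits)
  ultimately show ?thesis
    by blast
qed

lemma cycle_vertex_adj_iff:
  assumes i: "i < N" and i': "i' < N" "Suc i' mod N = i"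
  shows "(pt i 0, w) \<in> E \<longleftrightarrow> w = pt (Suc i mod N) 0 \<or> w = pt i' 0 \<or> P i \<noteq> [] \<and> w = pt i 1"
proof
  assume "(pt i 0, w) \<in> E"
  then show "w = pt (Suc i mod N) 0 \<or> w = pt i' 0 \<or> P i \<noteq> [] \<and> w = pt i 1"
  proof (cases rule: E_cases)
    case (cycle j)
    then have val: "valid j 0" "valid (Suc j mod N) 0" "valid i 0"
      using N_pos i by auto
    from cycle(2) show ?thesis
    proof (elim disjE conjE)
      assume "pt i 0 = pt j 0" "w = pt (Suc j mod N) 0"
      then show ?thesis
        using pt_inj[OF val(3,1)] by simp
    next
      assume "w = pt j 0" "pt i 0 = pt (Suc j mod N) 0"
      moreover from this have "Suc j mod N = Suc i' mod N"
        using pt_inj[OF val(3,2)] i' by simp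
      then have "j = i'"
        using cycle(1) i' by (auto simp: mod_if split: if_splits)
      ultimately show ?thesis
        by blast
    qed
  next
    case (branch j h)
    then have val: "valid j h" "valid j (Suc h)" "valid i 0"
      using i by auto
    from branch(3) show ?thesis
    proof (elim disjE conjE)
      assume "pt i 0 = pt j h" "w = pt j (Suc h)"
      then show ?thesis
        using pt_inj[OF val(3,1)] branch by auto
    next
      assume "w = pt j h" "pt i 0 = pt j (Suc h)"
      then show ?thesis
        using pt_inj[OF val(3,2)] by simp
    qed
  qed
next
  have "P i \<noteq> [] \<Longrightarrow> (pt i 0, pt i 1) \<in> E"
    using E_branch[of i 0] i by (simp del: pt_0)
  then show "w = pt (Suc i mod N) 0 \<or> w = pt i' 0 \<or> P i \<noteq> [] \<and> w = pt i 1 \<Longrightarrow> (pt i 0, w) \<in> E"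
    using E_cycle[OF i] E_cycle[OF i'(1)] i' sym by blast
qed

lemma degree_2_iff:
  assumes i: "i < N"
  shows "card {w. (cs ! i, w) \<in> E} = 2 \<longleftrightarrow> P i = []"
proof -
  obtain i' where i': "i' < N" "Suc i' mod N = i"
  proof (cases i)
    case 0
    then show ?thesis
      using that[of "N - 1"] N_pos by simp
  next
    case (Suc j)
    then show ?thesis
      using that[of j] i by simp
  qed
  have nbrs: "{w. (cs ! i, w) \<in> E} = {pt (Suc i mod N) 0, pt i' 0} \<union> (if P i = [] then {} else {pt i 1})"
    using cycle_vertex_adj_iff[OF i i'] by auto
  have val: "valid (Suc i mod N) 0" "valid i' 0"
    using i' N_pos by auto
  have "Suc i mod N \<noteq> i'"
    using i i' len by (auto simp: mod_if split: if_splits)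
  then have ne: "pt (Suc i mod N) 0 \<noteq> pt i' 0"
    using pt_inj[OF val] by blast
  show ?thesis
  proof (cases "P i = []")
    case True
    then show ?thesis
      using ne unfolding nbrs by (simp del: pt_0)
  next
    case False
    then have "valid i 1"
      using i by (cases "P i") auto
    then have "pt i 1 \<noteq> pt (Suc i mod N) 0" "pt i 1 \<noteq> pt i' 0"
      using pt_inj[of i 1 _ 0] val by auto
    then show ?thesis
      using ne False unfolding nbrs by (simp del: pt_0 add: card_insert_if)
  qed
qed

end

section \<open>Rotating a sun\<close>

text \<open>
  The blocked positions form an interval around the cycle. It starts at the first position beyond
  those opposite to the edge, which is \<open>k + 2\<close> for \<open>N = 2 * k\<close> and \<open>k + 3\<close> for \<open>N = 2 * k + 1\<close>, and it has
  \<open>2 * k - 2\<close> elements in both cases.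
\<close>

lemma blocked_iff_consecutive:
  assumes N: "3 \<le> N" and j: "j < N"
  shows "blocked N j \<longleftrightarrow> (\<exists>i < 2 * (N div 2) - 2. j = ((N + 1) div 2 + 2 + i) mod N)"
proof -
  define s where "s = (N + 1) div 2 + 2"
  define k where "k = N div 2"
  have k: "N = 2 * k \<and> s = k + 2 \<or> N = 2 * k + 1 \<and> s = k + 3"
    unfolding s_def k_def by presburger
  have "\<exists>i < 2 * k - 2. j = (s + i) mod N" if "blocked N j"
  proof (cases "s \<le> j")
    case True
    then show ?thesis
      using j k by (intro exI[of _ "j - s"]) auto
  next
    case False
    then have "s \<le> N" "j + N - s < 2 * k - 2" "s + (j + N - s) = j + N"
      using that N j k by (auto simp: blocked_def)
    then show ?thesis
      using j by (intro exI[of _ "j + N - s"]) simp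
  qed
  moreover have "blocked N j" if i: "i < 2 * k - 2" "j = (s + i) mod N" for i
  proof -
    have "j = s + i \<or> j + N = s + i"
    proof (cases "s + i < N")
      case False
      moreover have "s + i - N < N"
        using i k by auto
      ultimately show ?thesis
        using i(2) by (simp add: le_mod_geq)
    qed (use i in simp)
    then show ?thesis
      using i(1) k by (auto simp: blocked_def)
  qed
  ultimately show ?thesis
    unfolding s_def k_def by blast
qed

lemma sun_graph_rotate:
  assumes "cs \<noteq> []"
  shows "sun_graph (rotate k cs) (\<lambda>i. P ((k + i) mod length cs)) = sun_graph cs P"
proof -
  let ?N = "length cs"
  have shift: "(\<lambda>i. (k + i) mod ?N) ` {..<?N} = {..<?N}"
    using assms shift_mod_image by blast
  have reindex: "(\<Union>i<?N. F ((k + i) mod ?N)) = (\<Union>i<?N. F i)" for F :: "nat \<Rightarrow> 'b set"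
    using shift by (metis (no_types, lifting) SUP_cong image_image)
  have arcs: "sun_arcs (rotate k cs) (\<lambda>i. P ((k + i) mod ?N)) = sun_arcs cs P"
    unfolding sun_arcs_def cycle_arcs_rotate length_rotate
    using reindex[of "\<lambda>i. set (vwalk_arcs (cs ! i # P i))"] by (simp add: nth_rotate)
  have "rotate k cs \<noteq> []"
    using assms by simp
  show ?thesis
  proof (rule pair_pre_digraph.equality)
    show "pverts (sun_graph (rotate k cs) (\<lambda>i. P ((k + i) mod ?N))) = pverts (sun_graph cs P)"
      using reindex[of "\<lambda>i. set (P i)"]
      by (simp add: sun_graph_simps(1)[OF assms] sun_graph_simps(1)[OF \<open>rotate k cs \<noteq> []\<close>])
    show "parcs (sun_graph (rotate k cs) (\<lambda>i. P ((k + i) mod ?N))) = parcs (sun_graph cs P)"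
      unfolding sun_graph_simps(2)[OF assms] sun_graph_simps(2)[OF \<open>rotate k cs \<noteq> []\<close>] arcs ..
  qed simp
qed

lemma generalized_sun_rotate:
  assumes "generalized_sun m cs G"
  shows "generalized_sun m (rotate k cs) G"
proof -
  obtain P where m: "3 \<le> m" "length cs = m" "distinct cs"
    and P: "\<And>i. i < m \<Longrightarrow> distinct (P i) \<and> set (P i) \<inter> set cs = {}"
    and disj: "disjoint_family_on (\<lambda>i. set (P i)) {..<m}" and G: "G = sun_graph cs P"
    using assms unfolding generalized_sun_def by blast
  have "0 < m" "cs \<noteq> []"
    using m by auto
  have lt: "(k + i) mod m < m" for i
    using \<open>0 < m\<close> by simp
  have inj: "inj_on (\<lambda>i. (k + i) mod m) {..<m}"
    using shift_mod_image[OF \<open>0 < m\<close>, of k] by (intro eq_card_imp_inj_on) simp_all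
  have "disjoint_family_on (\<lambda>i. set (P ((k + i) mod m))) {..<m}"
    unfolding disjoint_family_on_def
  proof (intro ballI impI)
    fix i j assume "i \<in> {..<m}" "j \<in> {..<m}" "i \<noteq> j"
    then have "(k + i) mod m \<noteq> (k + j) mod m"
      using inj by (meson inj_onD)
    then show "set (P ((k + i) mod m)) \<inter> set (P ((k + j) mod m)) = {}"
      using disj lt unfolding disjoint_family_on_def by blast
  qed
  moreover have "G = sun_graph (rotate k cs) (\<lambda>i. P ((k + i) mod m))"
    using sun_graph_rotate[OF \<open>cs \<noteq> []\<close>, of k P] m G by simp
  moreover have "\<forall>i<m. distinct (P ((k + i) mod m)) \<and> set (P ((k + i) mod m)) \<inter> set (rotate k cs) = {}"
    using P lt by simp
  ultimately show ?thesis
    unfolding generalized_sun_def using m by (metis distinct_rotate length_rotate)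
qed

section \<open>Equality of the two dimensions\<close>

context conn_graph
begin

lemma out_degree_eq: "out_degree (with_proj G) v = card {w. (v, w) \<in> parcs G}"
proof -
  have "out_arcs (with_proj G) v = Pair v ` {w. (v, w) \<in> parcs G}"
    by (auto simp: out_arcs_def)
  then show ?thesis
    unfolding out_degree_def by (simp add: card_image inj_on_def)
qed

lemma generalized_sun_iff:
  "generalized_sun m cs G \<longleftrightarrow> m = length cs \<and> (\<exists>P. sun (pverts G) (parcs G) cs P)"
proof
  assume "generalized_sun m cs G"
  then obtain P where m: "3 \<le> m" "length cs = m" "distinct cs"
    and P: "\<And>i. i < m \<Longrightarrow> distinct (P i) \<and> set (P i) \<inter> set cs = {}"
    and disj: "disjoint_family_on (\<lambda>i. set (P i)) {..<m}" and G: "G = sun_graph cs P"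
    unfolding generalized_sun_def by blast
  have "cs \<noteq> []"
    using m by auto
  then have "sun (pverts G) (parcs G) cs P"
    by unfold_locales (use m P disj G in \<open>simp_all add: sun_graph_simps\<close>)
  then show "m = length cs \<and> (\<exists>P. sun (pverts G) (parcs G) cs P)"
    using m by blast
next
  assume "m = length cs \<and> (\<exists>P. sun (pverts G) (parcs G) cs P)"
  then obtain P where m: "m = length cs" and "sun (pverts G) (parcs G) cs P"
    by blast
  then interpret sun "pverts G" "parcs G" cs P
    by blast
  have "cs \<noteq> []"
    using N_pos by auto
  then have "G = sun_graph cs P"
    using V_eq E_eq by (intro pair_pre_digraph.equality) (simp_all add: sun_graph_simps)
  then show "generalized_sun m cs G"
    unfolding generalized_sun_def using m dist len dist_P P_off_cycle disjoint_P by blast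
qed

lemma ucycle_of_unicyclic:
  assumes "unicyclic G" and C: "cycle_graph cs \<in> cycles_of G" "distinct cs" "3 \<le> length cs"
  shows "ucycle (pverts G) (parcs G) cs"
proof
  have ne: "cs \<noteq> []"
    using C by auto
  show "cycle_arcs cs \<subseteq> parcs G"
    using C(1) by (auto simp: cycles_of_def subgraph_def cycle_graph_simps[OF ne])
  fix u w assume "(u, w) \<in> parcs G" "(u, w) \<notin> cycle_arcs cs \<union> (cycle_arcs cs)\<inverse>"
  then show "bridge u w"
    using unique_cycle_bridge[of "cycle_graph cs"] assms(1) C(1)
    unfolding unicyclic_def cycle_graph_simps[OF ne] by blast
qed (use C in auto)

definition blocked_degree_two :: "'a list \<Rightarrow> bool" where
  "blocked_degree_two cs \<longleftrightarrow>
    (\<forall>i<length cs. blocked (length cs) i \<longrightarrow> out_degree (with_proj G) (cs ! i) = 2)"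

text \<open>
  Equality of the dimensions makes a minimum connected resolving set also a minimum resolving set. If
  it had three or more elements, the explicit resolving sets of suns would be smaller.
\<close>

lemma sun_of_equal_dims:
  assumes U: "ucycle (pverts G) (parcs G) cs" and dims: "connected_metric_dim G = metric_dim G"
  obtains k where "generalized_sun (length cs) (rotate k cs) G" "blocked_degree_two (rotate k cs)"
proof -
  interpret ucycle "pverts G" "parcs G" cs
    by (rule U)
  obtain S where S: "resolves S" "conn_on S" "card S = metric_dim G"
    using connected_metric_dim_attained dims by metis
  have finS: "finite S"
    using S(1) fin finite_subset unfolding resolves_def by blast
  have sun: "\<exists>P. sun (pverts G) (parcs G) (rotate k cs) P" if "S \<subseteq> set cs" for k
  proof -
    interpret R: ucycle "pverts G" "parcs G" "rotate k cs"
      by (rule ucycle_rotate)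
    obtain P where "(\<forall>i<length (rotate k cs). distinct (P i) \<and> set (P i) \<inter> set (rotate k cs) = {}) \<and>
      disjoint_family_on (\<lambda>i. set (P i)) {..<length (rotate k cs)} \<and>
      pverts G = set (rotate k cs) \<union> (\<Union>i<length (rotate k cs). set (P i)) \<and>
      parcs G = sun_arcs (rotate k cs) P \<union> (sun_arcs (rotate k cs) P)\<inverse>"
      using R.resolved_from_cycle_is_sun[OF S(1)] \<open>S \<subseteq> set cs\<close> by auto
    then have "sun (pverts G) (parcs G) (rotate k cs) P"
      using R.dist R.len by unfold_locales blast+
    then show ?thesis
      by blast
  qed
  have "card S = 2"
  proof (rule ccontr)
    assume "card S \<noteq> 2"
    then have 3: "3 \<le> card S"
      using resolves_card_ge_2[OF S(1)] by linarith
    have min: "\<not> resolves (S - {v})" if "v \<in> S" for v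
    proof
      assume "resolves (S - {v})"
      then have "metric_dim G \<le> card (S - {v})"
        by (rule metric_dim_le)
      then show False
        using that finS S(3) 3 by simp
    qed
    obtain k where k: "{rotate k cs ! 0, rotate k cs ! 1, rotate k cs ! (N - 1)} \<subseteq> S"
      using minimal_consecutive[OF S(1,2) 3 min] .
    obtain P where "sun (pverts G) (parcs G) (rotate k cs) P"
      using sun minimal_on_cycle[OF S(1,2) 3 min] by blast
    then interpret R: sun "pverts G" "parcs G" "rotate k cs" P .
    have no_smaller: "card S \<le> card T" if "resolves T" for T
      using metric_dim_le[OF that] S(3) by simp
    have "N \<noteq> 3"
    proof
      assume "N = 3"
      then have "\<not> blocked N i" if "i < N" for i
        using that by (auto simp: blocked_def)
      then have "card S \<le> card {rotate k cs ! 0, rotate k cs ! 1}"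
        by (intro no_smaller R.edge_resolves) auto
      also have "\<dots> \<le> 2"
        by (simp add: card_insert_if)
      finally show False
        using 3 by simp
    qed
    then have "4 \<le> N"
      using len by linarith
    have "card S \<le> 3"
    proof -
      have "card S \<le> card {rotate k cs ! 0, rotate k cs ! 1, rotate k cs ! ((length (rotate k cs) + 1) div 2)}"
        by (rule no_smaller[OF R.triple_resolves])
      also have "\<dots> \<le> 3"
        by (simp add: card_insert_if)
      finally show ?thesis .
    qed
    moreover have "rotate k cs ! i = rotate k cs ! j \<longleftrightarrow> i = j" if "i < N" "j < N" for i j
      using that dist by (simp add: nth_eq_iff_index_eq)
    from this[of 0 1] this[of 0 "N - 1"] this[of 1 "N - 1"]
    have "card {rotate k cs ! 0, rotate k cs ! 1, rotate k cs ! (N - 1)} = 3"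
      using \<open>4 \<le> N\<close> N_pos by (simp add: card_insert_if)
    ultimately have "{rotate k cs ! 0, rotate k cs ! 1, rotate k cs ! (N - 1)} = S"
      using k finS 3 by (intro card_subset_eq) auto
    then obtain T where "resolves T" "card T \<le> 2"
      using R.path3_not_optimal S(1) \<open>4 \<le> N\<close> by auto
    then show False
      using no_smaller 3 by fastforce
  qed
  then obtain k where k: "S = {rotate k cs ! 0, rotate k cs ! 1}"
    using adjacent_pair[OF S(1,2)] by blast
  have "rotate k cs ! i \<in> set cs" if "i < N" for i
    using nth_mem[of i "rotate k cs"] that by simp
  moreover have "0 < N" "1 < N"
    using len by linarith+
  ultimately have "S \<subseteq> set cs"
    using k by blast
  then obtain P where sunP: "sun (pverts G) (parcs G) (rotate k cs) P"
    using sun by blast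
  then interpret R: sun "pverts G" "parcs G" "rotate k cs" P .
  have "blocked_degree_two (rotate k cs)"
    unfolding blocked_degree_two_def out_degree_eq
    using R.degree_2_iff R.edge_resolvesD S(1) k by blast
  moreover have "generalized_sun (length cs) (rotate k cs) G"
    using generalized_sun_iff sunP by auto
  ultimately show ?thesis
    using that by blast
qed

lemma connected_metric_dim_le_2:
  assumes sun: "generalized_sun m cs G" and deg: "blocked_degree_two cs"
  shows "connected_metric_dim G \<le> 2"
proof -
  obtain P where "sun (pverts G) (parcs G) cs P"
    using generalized_sun_iff sun by blast
  then interpret sun "pverts G" "parcs G" cs P .
  have "resolves {cs ! 0, cs ! 1}"
    using edge_resolves degree_2_iff deg unfolding blocked_degree_two_def out_degree_eq by blast
  moreover have "(cs ! 0, cs ! 1) \<in> parcs G"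
    using E_cycle[of 0] len N_pos by simp
  then have "conn_on {cs ! 0, cs ! 1}"
    unfolding conn_on_def using sym by auto
  ultimately have "connected_metric_dim G \<le> card {cs ! 0, cs ! 1}"
    by (rule connected_metric_dim_le)
  also have "\<dots> \<le> 2"
    by (simp add: card_insert_if)
  finally show ?thesis .
qed

lemma consecutive_of_blocked:
  assumes "3 \<le> length cs" and "blocked_degree_two cs"
  shows "consecutive_degree_two (2 * (length cs div 2) - 2) cs G"
proof -
  have "0 < length cs"
    using assms(1) by linarith
  then show ?thesis
    using assms blocked_iff_consecutive[OF assms(1)] mod_less_divisor
    unfolding consecutive_degree_two_def blocked_degree_two_def by metis
qed

text \<open>
  The rotation moves the given interval of degree-two vertices, which starts at \<open>j\<close>, to the interval
  of blocked positions, which starts at \<open>s\<close>. The shift is \<open>j - s\<close> modulo the length, written without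
  negative numbers.
\<close>

lemma blocked_of_consecutive:
  assumes N: "3 \<le> length cs" and deg: "consecutive_degree_two (2 * (length cs div 2) - 2) cs G"
  obtains k where "blocked_degree_two (rotate k cs)"
proof -
  let ?N = "length cs"
  obtain j where j: "\<And>i. i < 2 * (?N div 2) - 2 \<Longrightarrow> out_degree (with_proj G) (cs ! ((j + i) mod ?N)) = 2"
    using deg unfolding consecutive_degree_two_def by blast
  define s where "s = (?N + 1) div 2 + 2"
  define k where "k = j + (?N - s mod ?N)"
  have N_pos: "0 < ?N"
    using N by linarith
  have "k + s mod ?N = j + ?N"
    unfolding k_def using mod_less_divisor[OF N_pos, of s] by linarith
  moreover have "?N * (s div ?N) + s mod ?N = s"
    by simp
  moreover have "?N * (s div ?N + 1) = ?N * (s div ?N) + ?N"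
    by simp
  ultimately have ks: "k + s = j + ?N * (s div ?N + 1)"
    by linarith
  have "blocked_degree_two (rotate k cs)"
    unfolding blocked_degree_two_def length_rotate
  proof (intro allI impI)
    fix l assume l: "l < ?N" "blocked ?N l"
    then obtain i where i: "i < 2 * (?N div 2) - 2" "l = (s + i) mod ?N"
      using blocked_iff_consecutive[OF N l(1)] unfolding s_def by blast
    have "(k + l) mod ?N = (k + s + i) mod ?N"
      unfolding i(2) by (simp add: mod_simps add.assoc)
    also have "\<dots> = (j + i + ?N * (s div ?N + 1)) mod ?N"
      unfolding ks by (simp add: algebra_simps)
    also have "\<dots> = (j + i) mod ?N"
      by (rule mod_mult_self2)
    finally have "rotate k cs ! l = cs ! ((j + i) mod ?N)"
      using l by (simp add: nth_rotate)
    then show "out_degree (with_proj G) (rotate k cs ! l) = 2"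
      using j i by simp
  qed
  then show ?thesis
    by (rule that)
qed

lemma equal_dims_of_sun:
  assumes U: "ucycle (pverts G) (parcs G) cs" 
    and sun: "generalized_sun m cs' G" and deg: "consecutive_degree_two (2 * (m div 2) - 2) cs' G"
  shows "connected_metric_dim G = metric_dim G"
proof -
  interpret ucycle "pverts G" "parcs G" cs
    by (rule U)
  have m: "3 \<le> length cs'" "m = length cs'"
    using sun by (auto simp: generalized_sun_def)
  then obtain k where "blocked_degree_two (rotate k cs')"
    using blocked_of_consecutive deg by metis
  then have "connected_metric_dim G \<le> 2"
    using connected_metric_dim_le_2 generalized_sun_rotate[OF sun] by blast
  moreover have "2 \<le> metric_dim G"
    using metric_dim_attained resolves_card_ge_2 by metis
  ultimately show ?thesis
    using metric_dim_le_connected by linarith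
qed

end

theorem theorem7p5:
  fixes G C :: "'a pair_pre_digraph"
  assumes "unicyclic G" and "C \<in> cycles_of G"
  shows "(odd (card (pverts C)) \<longrightarrow>
            (connected_metric_dim G = metric_dim G \<longleftrightarrow> G \<in> U1)) \<and>
         (even (card (pverts C)) \<longrightarrow>
            (connected_metric_dim G = metric_dim G \<longleftrightarrow> G \<in> U2))"
proof -
  interpret conn_graph G
    using assms(1) by (intro conn_graph.intro) (auto simp: unicyclic_def)
  obtain cs where cs: "distinct cs" "3 \<le> length cs" "C = cycle_graph cs"
    using assms(2) unfolding cycles_of_def by blast
  have U: "ucycle (pverts G) (parcs G) cs"
    using ucycle_of_unicyclic[OF assms(1)] assms(2) cs by blast
  have "cs \<noteq> []"
    using cs by auto
  then have card_C: "card (pverts C) = length cs"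
    using cs by (simp add: cycle_graph_simps distinct_card)
  have "connected_metric_dim G = metric_dim G" if "G \<in> U1 \<union> U2"
  proof -
    have "connected_metric_dim G = metric_dim G"
      if "generalized_sun m cs' G" "consecutive_degree_two (2 * k - 2) cs' G" "m = 2 * k + 1 \<or> m = 2 * k"
      for k m cs'
      using equal_dims_of_sun[OF U that(1)] that(2,3) by auto
    then show ?thesis
      using that unfolding U1_def U2_def by blast
  qed
  moreover have "(odd (length cs) \<longrightarrow> G \<in> U1) \<and> (even (length cs) \<longrightarrow> G \<in> U2)"
    if eq: "connected_metric_dim G = metric_dim G"
  proof -
    obtain r where r: "generalized_sun (length cs) (rotate r cs) G" "blocked_degree_two (rotate r cs)"
      using sun_of_equal_dims[OF U eq] .
    have deg: "consecutive_degree_two (2 * (length cs div 2) - 2) (rotate r cs) G"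
      using consecutive_of_blocked[OF _ r(2)] cs by simp
    show ?thesis
    proof (intro conjI impI)
      assume "odd (length cs)"
      then obtain k where k: "length cs = 2 * k + 1"
        by (rule oddE)
      then have "1 \<le> k"
        using cs by linarith
      then show "G \<in> U1"
        unfolding U1_def using r(1) deg k by auto
    next
      assume "even (length cs)"
      then obtain k where k: "length cs = 2 * k"
        by (rule evenE)
      then have "2 \<le> k"
        using cs by linarith
      then show "G \<in> U2"
        unfolding U2_def using r(1) deg k by auto
    qed
  qed
  ultimately show ?thesis
    unfolding card_C by blast
qed

end
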